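(* Let $g$ solve system (S3) with initial data $h_{ii}>0$, $h_{11}\le h_{22}\le h_{33}$, and suppose $h\in D_\infty$, i.e. along the solution of the planar system (P) starting at $(h_{00}^{1/3}h_{22},h_{00}^{1/3}h_{33})$ one has $b,c\to\infty$. Then the solution of (S3) exists for all $t\ge0$ and as $t\to\infty$: $g_{00}\to0$, $g_{11}\to 0$, $g_{22},g_{33}\to\infty$, and $g_{33}-g_{22}\to0$.
   Context: Let $\det h = h_{00}h_{11}h_{22}h_{33}$, $\beta=\frac{1}{6(\det h)^2}$, $p(x,y,z) = x^4 - x^3(y+z) + x^2yz + x(-y^3+y^2z+yz^2-z^3) + y^4 - y^3z - yz^3 + z^4$, $q(x,y,z) = 5x^4 - 3x^3(y+z) + x^2yz + x(y^3-y^2z-yz^2+z^3) - 3y^4 + 3y^3z + 3yz^3 - 3z^4$, $r(x,y,z) = \tfrac12(p+3q)(x,y,z) = 8x^4-5x^3(y+z)+2x^2yz+x(y^3-y^2z-yz^2+z^3)-4y^4+4y^3z+4yz^3-4z^4$. System (S3): $\dot g_{00} = -\beta\,p(g_{11},g_{22},g_{33})\,g_{00}^3$, $\dot g_{11} = -\beta\,q(g_{11},g_{22},g_{33})\,g_{00}^2g_{11}$, $\dot g_{22} = -\beta\,q(g_{22},g_{33},g_{11})\,g_{00}^2g_{22}$, $\dot g_{33} = -\beta\,q(g_{33},g_{11},g_{22})\,g_{00}^2g_{33}$, $g_{ii}(0)=h_{ii}$ (Bach flow on $\mathbb{R}\times\mathbb{S}^3$ in a diagonalizing frame; $g_{00}g_{11}g_{22}g_{33}=\det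 h$ is preserved). Set $a=g_{00}^{1/3}g_{11}$, $b=g_{00}^{1/3}g_{22}$, $c=g_{00}^{1/3}g_{33}$, so $abc=\det h$. Under (S3), $(b,c)$ follows, up to a time reparametrization, the planar system (P): $\dot b=-\tfrac23 r(b,a,c)\,b$, $\dot c=-\tfrac23 r(c,a,b)\,c$ with $a=\det h/(bc)$, on the region $a\le b\le c$. $D_\infty$ denotes the set of initial metrics whose (P)-trajectory has $b,c\to\infty$. *)

theory Defs
  imports "HOL-Analysis.Analysis"
begin

definition pp :: "real \<Rightarrow> real \<Rightarrow> real \<Rightarrow> real" where
  "pp x y z = x^4 - x^3*(y+z) + x^2*y*z + x*(-(y^3) + y^2*z + y*z^2 - z^3)
              + y^4 - y^3*z - y*z^3 + z^4"

definition qq :: "real \<Rightarrow> real \<Rightarrow> real \<Rightarrow> real" where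
  "qq x y z = 5*x^4 - 3*x^3*(y+z) + x^2*y*z + x*(y^3 - y^2*z - y*z^2 + z^3)
              - 3*y^4 + 3*y^3*z + 3*y*z^3 - 3*z^4"

definition rr :: "real \<Rightarrow> real \<Rightarrow> real \<Rightarrow> real" where
  "rr x y z = (pp x y z + 3 * qq x y z) / 2"

definition bach_beta :: "real \<Rightarrow> real" where
  "bach_beta D = 1 / (6 * D^2)"

definition S3_solution ::
  "real \<Rightarrow> real \<Rightarrow> real \<Rightarrow> real \<Rightarrow> real set \<Rightarrow>
   (real \<Rightarrow> real) \<Rightarrow> (real \<Rightarrow> real) \<Rightarrow> (real \<Rightarrow> real) \<Rightarrow> (real \<Rightarrow> real) \<Rightarrow> bool" where
  "S3_solution h0 h1 h2 h3 I g0 g1 g2 g3 \<longleftrightarrow>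
     (let \<beta> = bach_beta (h0*h1*h2*h3) in
     g0 0 = h0 \<and> g1 0 = h1 \<and> g2 0 = h2 \<and> g3 0 = h3 \<and>
     (\<forall>t\<in>I.
        (g0 has_real_derivative (- \<beta> * pp (g1 t) (g2 t) (g3 t) * (g0 t)^3)) (at t within I) \<and>
        (g1 has_real_derivative (- \<beta> * qq (g1 t) (g2 t) (g3 t) * (g0 t)^2 * g1 t)) (at t within I) \<and>
        (g2 has_real_derivative (- \<beta> * qq (g2 t) (g3 t) (g1 t) * (g0 t)^2 * g2 t)) (at t within I) \<and>
        (g3 has_real_derivative (- \<beta> * qq (g3 t) (g1 t) (g2 t) * (g0 t)^2 * g3 t)) (at t within I)))"

definition P_solution ::
  "real \<Rightarrow> real \<Rightarrow> real \<Rightarrow> real set \<Rightarrow> (real \<Rightarrow> real) \<Rightarrow> (real \<Rightarrow> real) \<Rightarrow> bool" where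
  "P_solution D b0 c0 I b c \<longleftrightarrow>
     b 0 = b0 \<and> c 0 = c0 \<and>
     (\<forall>t\<in>I.
        (b has_real_derivative (- (2/3) * rr (b t) (D / (b t * c t)) (c t) * b t)) (at t within I) \<and>
        (c has_real_derivative (- (2/3) * rr (c t) (D / (b t * c t)) (b t) * c t)) (at t within I))"

text \<open>D_infinity: the (P)-trajectory starting at (h0^(1/3) h2, h0^(1/3) h3) has b, c \<rightarrow> \<infinity>,
  either on a maximal interval [0,T) with T finite, or on [0,\<infinity>).\<close>
definition D_infty :: "real \<Rightarrow> real \<Rightarrow> real \<Rightarrow> real \<Rightarrow> bool" where
  "D_infty h0 h1 h2 h3 \<longleftrightarrow>
     (let D = h0*h1*h2*h3; b0 = root 3 h0 * h2; c0 = root 3 h0 * h3 in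
      (\<exists>b c. P_solution D b0 c0 {0..} b c \<and>
             filterlim b at_top at_top \<and> filterlim c at_top at_top) \<or>
      (\<exists>T>0. \<exists>b c. P_solution D b0 c0 {0..<T} b c \<and>
             filterlim b at_top (at_left T) \<and> filterlim c at_top (at_left T)))"

end

theory Submission
  imports Defs
begin

text \<open>
  Given an escaping trajectory $(b,c)$ of (P), put $a = D/(bc)$, let $E' = p(a,b,c)$ and
  $k = h_{00}^{1/3} e^{-E/3}$. Then $g_{00} = k^3$, $g_{11} = a/k$, $g_{22} = b/k$, $g_{33} = c/k$
  solves (S3) in the time $t$ with $ds/dt = \beta k^2$, and by uniqueness it is the only solution.

  The product $u = bc$ satisfies $u' = \frac23 r(a,b,c) u$, which is bounded once $b$ and $c$ are
  large. Hence escape takes infinite (P)-time and $u = O(1+s)$, so that eventually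
  $p(a,b,c) \ge aD/2 \ge \kappa/(1+s)$, whose integral diverges: $k \to 0$, and then $t \to \infty$.
  The gap $x = c - b$ satisfies $x' = -\frac23 W x$ with $W \ge 8c^4$ eventually. This makes $x/k$
  decay exponentially, and it makes $\ln (a/k) + x^2$ decrease at rate at least $\kappa/(1+s)$, so
  $a/k \to 0$.
\<close>

section \<open>The planar system\<close>

text \<open>The cancellation behind the lift is \<open>r = (p + 3q)/2\<close>: if
  \<open>k' = -p k / 3\<close>, then dividing a solution of \<open>f' = -(2/3) r f\<close> by
  \<open>k\<close> leaves exactly the rate \<open>-q\<close>. Homogeneity of degree 4 then fixes the
  clock: (S3) carries the factor \<open>g0^2 = k^6\<close>, while \<open>p\<close> and
  \<open>q\<close> at the rescaled arguments carry \<open>k^-4\<close>, which leaves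
  \<open>k^2\<close>. The obstacle is that the limit is degenerate. The parts of \<open>p\<close>
  and \<open>q\<close> that are quartic in \<open>b\<close>, \<open>c\<close> contain the factor
  \<open>(c - b)^2\<close>, so near the diagonal \<open>b = c\<close> the leading term is only
  \<open>a^2 b c = a D\<close>, which tends to 0 and whose integral is bounded below by no more than
  a multiple of a logarithm. Every other term must therefore be absorbed at the order of
  \<open>a D\<close>, or by the fast contraction of the gap. Nor is it enough that \<open>a\<close>
  and \<open>c - b\<close> tend to 0 along (P): the metric components are quotients by
  \<open>k\<close>, which also tends to 0, so rates of decay have to be compared.\<close>

lemma rr_eq:
  "rr x y z = 8*x^4 - 5*x^3*(y+z) + 2*x^2*y*z + x*(y^3 - y^2*z - y*z^2 + z^3)
              - 4*y^4 + 4*y^3*z + 4*y*z^3 - 4*z^4"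
  unfolding rr_def pp_def qq_def by (simp add: field_simps)

text \<open>Sorted by powers of \<open>a\<close>, with the gap exposed:
  \<open>b^4 - b^3 c - b c^3 + c^4 = (c-b)^2 (b^2 + b c + c^2)\<close>. All later estimates of
  \<open>pp\<close>, \<open>qq\<close> and \<open>rr\<close> start from these three forms.\<close>

lemma pp_eq_diff:
  "pp a b c = (c-b)^2 * (b^2+b*c+c^2) - a*(b+c)*(c-b)^2 + a^2*b*c - a^3*(b+c) + a^4"
  unfolding pp_def by algebra

lemma qq_eq_diff:
  "qq a b c = 5*a^4 - 3*a^3*(b+c) + a^2*b*c + a*(b+c)*(c-b)^2 - 3*(c-b)^2*(b^2+b*c+c^2)"
  unfolding qq_def by algebra

lemma rr_eq_diff:
  "rr a b c = 8*a^4 - 5*a^3*(b+c) + 2*a^2*b*c + a*(b+c)*(c-b)^2 - 4*(c-b)^2*(b^2+b*c+c^2)"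
  unfolding rr_eq by algebra

text \<open>Infinitesimal form of the conservation of \<open>a b c\<close>: the logarithmic rates of
  the three factors add up to zero, so \<open>b c\<close> evolves with the rate of \<open>a\<close>
  reversed.\<close>

lemma rr_sum: "rr b a c + rr c a b = - rr a b c"
  unfolding rr_eq by algebra

lemma pp_commute: "pp x y z = pp y x z" "pp x y z = pp y z x"
  unfolding pp_def by algebra+

lemma qq_commute: "qq x y z = qq x z y"
  unfolding qq_def by algebra

lemma pp_scale: "pp (k*x) (k*y) (k*z) = k^4 * pp x y z"
  unfolding pp_def by algebra

lemma qq_scale: "qq (k*x) (k*y) (k*z) = k^4 * qq x y z"
  unfolding qq_def by algebra

text \<open>The factor \<open>W\<close> of the overview. The difference of the two (P)-velocities is
  antisymmetric under exchange of \<open>b\<close> and \<open>c\<close>, hence divisible by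
  \<open>c - b\<close>; this is the quotient, up to the factor 2/3.\<close>

definition gap_rate :: "real \<Rightarrow> real \<Rightarrow> real \<Rightarrow> real" where
  "gap_rate a b c = 8*c^4 + 7*c^3*b + 6*c^2*b^2 + 7*c*b^3 + 8*b^4
     - a*(5*c^3 + 7*b*c^2 + 7*b^2*c + 5*b^3) - a^2*b*c + a^3*(b+c) - 4*a^4"

lemma gap_rate_eq: "rr c a b * c - rr b a c * b = (c - b) * gap_rate a b c"
  unfolding rr_eq gap_rate_def by algebra

section \<open>Comparison and integration on a half-line\<close>

text \<open>The workhorse for all monotone quantities below. The derivative is taken within
  \<open>S\<close> because solutions have only a one-sided derivative at time 0.\<close>

lemma nonincreasing_within:
  fixes f f' :: "real \<Rightarrow> real"
  assumes "x \<le> y" "{x..y} \<subseteq> S"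
    and "\<And>s. s \<in> {x..y} \<Longrightarrow> (f has_real_derivative f' s) (at s within S)"
    and "\<And>s. s \<in> {x..y} \<Longrightarrow> f' s \<le> 0"
  shows "f y \<le> f x"
proof -
  have "\<exists>s\<in>{x..y}. f y - f x = f' s * (y - x)"
  proof (rule mvt_very_simple[OF assms(1)])
    fix s assume "x \<le> s" "s \<le> y"
    then have "(f has_real_derivative f' s) (at s within {x..y})"
      using assms(3)[of s] by (auto intro: DERIV_subset[OF _ assms(2)])
    then show "(f has_derivative (*) (f' s)) (at s within {x..y})"
      by (simp add: has_field_derivative_def)
  qed
  then show ?thesis
    using assms(1,4) by (metis diff_ge_0_iff_ge diff_le_0_iff_le mult_nonpos_nonneg)
qed

lemma antiderivative_atLeast:
  fixes f :: "real \<Rightarrow> real"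
  assumes "continuous_on {0..} f"
  shows "\<exists>F. F 0 = 0 \<and> (\<forall>t\<ge>0. (F has_real_derivative f t) (at t within {0..}))"
proof (intro exI[of _ "\<lambda>t. integral {0..t} f"] conjI allI impI)
  fix t :: real assume t: "t \<ge> 0"
  have "((\<lambda>x. integral {0..x} f) has_real_derivative f t) (at t within {0..t+1})"
    by (rule integral_has_real_derivative) (use t assms in \<open>auto intro: continuous_on_subset\<close>)
  \<comment> \<open>Integrating up to \<open>t+1\<close> keeps \<open>t\<close> away from the right
    end, so both sets agree near \<open>t\<close>.\<close>
  moreover have "at t within {0..t+1} = at t within {0..}"
    by (rule at_within_nhd[of t "{..<t+1}"]) (use t in auto)
  ultimately show "((\<lambda>x. integral {0..x} f) has_real_derivative f t) (at t within {0..})"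
    by simp
qed auto

text \<open>The integrating factor \<open>exp (- E)\<close> with \<open>E' = G\<close> turns
  \<open>f\<close> into a constant, so \<open>f\<close> keeps its initial sign.\<close>

lemma linear_ode_nonneg:
  fixes f G :: "real \<Rightarrow> real"
  assumes "continuous_on {0..} G" "f 0 \<ge> 0"
    and f: "\<And>t. t \<ge> 0 \<Longrightarrow> (f has_real_derivative f t * G t) (at t within {0..})"
    and "t \<ge> 0"
  shows "f t \<ge> 0"
proof -
  obtain E where E: "\<And>t. t \<ge> 0 \<Longrightarrow> (E has_real_derivative G t) (at t within {0..})"
    using antiderivative_atLeast[OF assms(1)] by blast
  let ?h = "\<lambda>t. f t * exp (- E t)"
  have d: "(?h has_real_derivative 0) (at s within {0..})" if "s \<ge> 0" for s
    by (rule derivative_eq_intros f E that | simp add: algebra_simps)+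
  have "- ?h t \<le> - ?h 0"
    by (rule nonincreasing_within[of 0 t "{0..}" _ "\<lambda>_. 0"])
       (use assms(4) DERIV_minus[OF d] in auto)
  moreover have "?h 0 \<ge> 0" using assms(2) by simp
  ultimately have "?h t \<ge> 0" by linarith
  then show ?thesis by (simp add: zero_le_mult_iff)
qed

lemma continuous_on_interval_bounded:
  fixes f :: "real \<Rightarrow> real"
  assumes "continuous_on {x..y} f"
  shows "\<exists>M. \<forall>s\<in>{x..y}. \<bar>f s\<bar> \<le> M"
  using compact_imp_bounded[OF compact_continuous_image[OF assms]] by (simp add: bounded_iff)

lemma positive_no_zero:
  fixes f :: "real \<Rightarrow> real"
  assumes "continuous_on {0..t} f" "f 0 > 0" "\<And>s. s \<in> {0..t} \<Longrightarrow> f s \<noteq> 0" "s \<in> {0..t}"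
  shows "f s > 0"
proof (rule ccontr)
  assume "\<not> f s > 0"
  then have "\<exists>r\<ge>0. r \<le> s \<and> f r = 0"
    using assms by (intro IVT2') (auto intro: continuous_on_subset)
  then show False using assms(3,4) by auto
qed

section \<open>Positivity and growth along (P)\<close>

lemma P_solution_subset:
  assumes "P_solution D b0 c0 I b c" "J \<subseteq> I"
  shows "P_solution D b0 c0 J b c"
  using assms unfolding P_solution_def by (meson DERIV_subset subsetD)

lemma P_solution_product:
  assumes "P_solution D b0 c0 I b c" "t \<in> I"
  shows "((\<lambda>t. b t * c t) has_real_derivative
           2/3 * rr (D / (b t * c t)) (b t) (c t) * (b t * c t)) (at t within I)"
proof -
  let ?a = "D / (b t * c t)"
  have "((\<lambda>t. b t * c t) has_real_derivative
     (- (2/3) * rr (b t) ?a (c t) * b t) * c t + (- (2/3) * rr (c t) ?a (b t) * c t) * b t) (at t within I)"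
    using assms unfolding P_solution_def by (intro DERIV_mult) auto
  also have "(- (2/3) * rr (b t) ?a (c t) * b t) * c t + (- (2/3) * rr (c t) ?a (b t) * c t) * b t
     = - (2/3) * (rr (b t) ?a (c t) + rr (c t) ?a (b t)) * (b t * c t)"
    by (simp add: algebra_simps)
  also have "\<dots> = 2/3 * rr ?a (b t) (c t) * (b t * c t)" by (simp add: rr_sum)
  finally show ?thesis .
qed

text \<open>Since $8a^4$ dominates for large $a$, the product $bc$ decays at most exponentially, so it
  cannot reach zero, where $D/(bc)$ would take the junk value 0.\<close>

lemma rr_lower_bound:
  assumes "a \<ge> 0" "\<bar>b\<bar> \<le> M" "\<bar>c\<bar> \<le> M"
  shows "rr a b c \<ge> - 152 * M^4"
proof -
  have M: "M \<ge> 0" using assms(2) by linarith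
  have bc: "\<bar>b * c\<bar> \<le> M^2"
    using mult_mono[OF assms(2,3)] M by (simp add: abs_mult power2_eq_square)
  have b2: "b^2 \<le> M^2" "c^2 \<le> M^2"
    using assms(2,3) M by (auto simp: abs_le_square_iff[symmetric])
  have x2: "(c - b)^2 \<le> 4 * M^2"
  proof -
    have "(c - b)^2 = c^2 + b^2 - 2 * (b * c)" by algebra
    with b2 bc show ?thesis by linarith
  qed
  have s: "b + c \<le> 2*M" "- (2*M) \<le> b + c" using assms(2,3) by linarith+
  have 1: "a^3 * (b + c) \<le> 2 * M * a^3"
    using mult_left_mono[OF s(1), of "a^3"] assms(1) by (simp add: mult.commute)
  have 2: "a^2 * (b * c) \<ge> - (M^2 * a^2)"
    using mult_left_mono[of "- (M^2)" "b * c" "a^2"] bc by (simp add: mult.commute)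
  have "(c - b)^2 * (b + c) \<ge> (c - b)^2 * (- (2*M))"
    using s(2) by (intro mult_left_mono) auto
  moreover have "(c - b)^2 * (2*M) \<le> (4 * M^2) * (2*M)"
    using x2 M by (intro mult_right_mono) auto
  ultimately have "(b + c) * (c - b)^2 \<ge> - (8 * M^3)"
    by (simp add: power2_eq_square power3_eq_cube mult.commute)
  then have 3: "a * ((b + c) * (c - b)^2) \<ge> - (8 * M^3 * a)"
    using mult_left_mono[of "- (8 * M^3)" "(b + c) * (c - b)^2" a] assms(1)
    by (simp add: mult.commute)
  have nonneg: "b^2 + b*c + c^2 \<ge> 0"
    using zero_le_power2[of "b + c"] zero_le_power2[of b] zero_le_power2[of c]
    unfolding power2_sum by linarith
  have "(c - b)^2 * (b^2 + b*c + c^2) \<le> (4 * M^2) * (3 * M^2)"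
    using x2 b2 bc by (intro mult_mono nonneg) (auto simp: abs_le_iff)
  then have 4: "(c - b)^2 * (b^2 + b*c + c^2) \<le> 12 * M^4"
    by (simp add: power_numeral_reduce mult_ac)
  have r: "rr a b c \<ge> 8*a^4 - 10*M*a^3 - 2*M^2*a^2 - 8*M^3*a - 48*M^4"
    using 1 2 3 4 unfolding rr_eq_diff by (simp add: mult.assoc)
  have "8*a^4 - 10*M*a^3 - 2*M^2*a^2 - 8*M^3*a \<ge> - 104 * M^4"
  \<comment> \<open>Below \<open>2*M\<close> the negative terms amount to at most
    \<open>(80 + 8 + 16) M^4 = 104 M^4\<close>. Above it they are at most
    \<open>(5 + 1/2 + 1) a^4\<close>, less than \<open>8 a^4\<close>. Together with
    \<open>48 M^4\<close> this gives the constant 152.\<close>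
  proof (cases "a \<le> 2*M")
    case True
    have "a^3 \<le> (2*M)^3" "a^2 \<le> (2*M)^2" using True assms(1) by (intro power_mono; simp)+
    then have "M * a^3 \<le> M * (2*M)^3" "M^2 * a^2 \<le> M^2 * (2*M)^2" "M^3 * a \<le> M^3 * (2*M)"
      using True M by (intro mult_left_mono; simp)+
    moreover have "a^4 \<ge> 0" by simp
    moreover have "M * (2*M)^3 = 8*M^4" "M^2 * (2*M)^2 = 4*M^4" "M^3 * (2*M) = 2*M^4"
      by algebra+
    ultimately show ?thesis by linarith
  next
    case False
    then have h: "M \<le> a/2" by simp
    then have "M^2 \<le> (a/2)^2" "M^3 \<le> (a/2)^3" using M by (intro power_mono; simp)+
    then have "M * a^3 \<le> a/2 * a^3" "M^2 * a^2 \<le> (a/2)^2 * a^2" "M^3 * a \<le> (a/2)^3 * a"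
      using h assms(1) by (intro mult_right_mono; simp)+
    moreover have "a^4 \<ge> 0" "M^4 \<ge> 0" by simp_all
    moreover have "a/2 * a^3 = a^4/2" "(a/2)^2 * a^2 = a^4/4" "(a/2)^3 * a = a^4/8"
      by (simp_all add: power_divide power_numeral_reduce)
    ultimately show ?thesis by linarith
  qed
  with r show ?thesis by linarith
qed

lemma P_solution_pos:
  assumes P: "P_solution D b0 c0 {0..t} b c" and "D > 0" "b0 > 0" "c0 > 0" "t \<ge> 0"
  shows "b t > 0 \<and> c t > 0"
proof -
  let ?u = "\<lambda>s. b s * c s"
  have cont: "continuous_on {0..t} b" "continuous_on {0..t} c"
    using P unfolding P_solution_def by (auto intro!: DERIV_continuous_on)
  have init: "b 0 > 0" "c 0 > 0" using P assms unfolding P_solution_def by auto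
  have cu: "continuous_on {0..t} ?u" using cont by (intro continuous_intros)
  obtain M1 where M1: "\<And>s. s \<in> {0..t} \<Longrightarrow> \<bar>b s\<bar> \<le> M1"
    using continuous_on_interval_bounded[OF cont(1)] by blast
  obtain M2 where M2: "\<And>s. s \<in> {0..t} \<Longrightarrow> \<bar>c s\<bar> \<le> M2"
    using continuous_on_interval_bounded[OF cont(2)] by blast
  define M where "M = max M1 M2"
  define K where "K = 2/3 * (152 * M^4)"
  \<comment> \<open>Look at the first zero \<open>z\<close> of the product. Before \<open>z\<close>
    the product is positive, so \<open>D / ?u s\<close> is positive there and
    \<open>rr_lower_bound\<close> applies.\<close>
  have nz: "?u s \<noteq> 0" if "s \<in> {0..t}" for s
  proof
    assume "?u s = 0"
    define Z where "Z = {s \<in> {0..t}. ?u s = 0}"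
    have Z: "Z \<noteq> {}" "bdd_below Z" using that \<open>?u s = 0\<close>
      by (auto simp: Z_def intro!: bdd_belowI[of _ 0])
    have "closed Z" unfolding Z_def
      by (rule continuous_closed_preimage_constant[OF cu closed_atLeastAtMost])
    then have iz: "Inf Z \<in> Z" by (rule closed_contains_Inf[OF Z])
    define z where "z = Inf Z"
    have z: "z \<in> {0..t}" "?u z = 0" using iz by (auto simp: Z_def z_def)
    have z0: "z > 0" using z init by (cases "z = 0") auto
    have nz: "?u s \<noteq> 0" if "s \<in> {0..<z}" for s
      using that cInf_lower[OF _ Z(2), of s] z by (auto simp: Z_def z_def)
    have pos: "?u s > 0" if "s \<in> {0..<z}" for s
      by (rule positive_no_zero[where f="?u" and t=s])
         (use that z nz init cu in \<open>auto intro: continuous_on_subset\<close>)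
    \<comment> \<open>\<open>K\<close> compensates the worst rate of decay of \<open>?u\<close>, so
      \<open>?h\<close> cannot decrease from its positive initial value to 0 at
      \<open>z\<close>.\<close>
    let ?h = "\<lambda>s. ?u s * exp (K * s)"
    have "?h 0 \<le> ?h z"
    proof (rule DERIV_nonneg_imp_increasing_open[where f="?h"])
      show "0 \<le> z" using z0 by simp
      show "continuous_on {0..z} ?h"
        using cu z by (intro continuous_intros continuous_on_subset[OF cont(1)]
            continuous_on_subset[OF cont(2)]) auto
      fix s assume s: "0 < s" "s < z"
      let ?r = "rr (D / ?u s) (b s) (c s)"
      have "(?u has_real_derivative 2/3 * ?r * ?u s) (at s within {0..t})"
        by (rule P_solution_product[OF P]) (use s z in auto)
      then have d: "(?u has_real_derivative 2/3 * ?r * ?u s) (at s)"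
        using s z at_within_interior[of s "{0..t}"] by simp
      have "(?h has_real_derivative (2/3 * ?r * ?u s + K * ?u s) * exp (K * s)) (at s)"
        by (rule derivative_eq_intros d | simp add: algebra_simps)+
      moreover have "?r \<ge> - 152 * M^4"
        using pos[of s] s z M1[of s] M2[of s] assms(2) by (intro rr_lower_bound) (auto simp: M_def)
      then have "(2/3 * ?r + K) * ?u s \<ge> 0"
        using pos[of s] s by (intro mult_nonneg_nonneg[of _ "?u s"]) (auto simp: K_def)
      then have "(2/3 * ?r * ?u s + K * ?u s) * exp (K * s) \<ge> 0"
        by (intro mult_nonneg_nonneg) (simp_all only: distrib_right exp_ge_zero)
      ultimately show "\<exists>y. (?h has_real_derivative y) (at s) \<and> 0 \<le> y" by blast
    qed
    then show False using init z by (simp add: mult_le_0_iff)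
  qed
  show ?thesis
    using positive_no_zero[OF cont(1) init(1), of t] positive_no_zero[OF cont(2) init(2), of t]
      nz assms(5) by auto
qed

text \<open>The rate of \<open>u = b c\<close> is \<open>2/3 * r * u\<close>. With
  \<open>b >= 1\<close> and \<open>c >= D\<close> one has \<open>a <= 1\<close>, and then the
  negative gap term of \<open>r\<close> outweighs the positive one. What is left is
  \<open>8 a^4 + 2 a^2 u\<close>; multiplied by \<open>u\<close> and simplified with
  \<open>a u = D\<close>, it is at most \<open>8 D + 2 D^2\<close>.\<close>

lemma product_linear_growth:
  assumes P: "P_solution D b0 c0 {0..t} b c" and "D > 0" "0 \<le> s" "s \<le> t"
    and large: "\<And>w. w \<in> {s..t} \<Longrightarrow> b w \<ge> max 1 D \<and> c w \<ge> max 1 D"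
  shows "b t * c t \<le> b s * c s + 2/3 * (2*D^2 + 8*D) * (t - s)"
proof -
  let ?K = "2/3 * (2*D^2 + 8*D)"
  let ?a = "\<lambda>w. D / (b w * c w)"
  have "b t * c t - ?K * t \<le> b s * c s - ?K * s"
  proof (rule nonincreasing_within[where S="{0..t}" and f="\<lambda>w. b w * c w - ?K * w"])
    fix w assume w: "w \<in> {s..t}"
    show "((\<lambda>w. b w * c w - ?K * w) has_real_derivative
        2/3 * rr (?a w) (b w) (c w) * (b w * c w) - ?K) (at w within {0..t})"
      by (rule DERIV_diff[OF P_solution_product[OF P] DERIV_cmult_Id]) (use w assms(3) in simp)
    define a u where "a = ?a w" and "u = b w * c w"
    have bc: "b w \<ge> 1" "c w \<ge> 1" "c w \<ge> D" using large[OF w] by auto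
    have uD: "u \<ge> D" "u > 0"
      using mult_mono[of 1 "b w" D "c w"] bc assms(2) by (auto simp: u_def)
    have a: "0 < a" "a \<le> 1" "a * u = D"
      using uD assms(2) by (auto simp: a_def u_def)
    have "a * (b w + c w) \<le> 1 * (b w + c w)" using a bc by (intro mult_right_mono) auto
    also have "\<dots> \<le> b w * b w + c w * c w"
    proof -
      have "b w * 1 \<le> b w * b w" "c w * 1 \<le> c w * c w" using bc by (intro mult_left_mono; simp)+
      then show ?thesis by simp
    qed
    also have "\<dots> \<le> 4 * ((b w)^2 + b w * c w + (c w)^2)"
    proof -
      have "b w * b w \<ge> 0" "c w * c w \<ge> 0" "b w * c w \<ge> 0" using bc by auto
      then show ?thesis by (simp add: power2_eq_square distrib_left)
    qed
    finally have "(c w - b w)^2 * (a * (b w + c w)) \<le> (c w - b w)^2 * (4 * ((b w)^2 + b w * c w + (c w)^2))"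
      by (intro mult_left_mono) auto
    moreover have "a^3 * (b w + c w) \<ge> 0" using a bc by simp
    ultimately have "rr a (b w) (c w) \<le> 8*a^4 + 2*a^2*u"
      unfolding rr_eq_diff u_def by (simp add: algebra_simps)
    then have "rr a (b w) (c w) * u \<le> (8*a^4 + 2*a^2*u) * u"
      using uD by (intro mult_right_mono) auto
    also have "\<dots> = 8 * a^3 * (a * u) + 2 * (a * u)^2" by algebra
    also have "\<dots> \<le> 8 * D + 2 * D^2"
      using power_le_one[of a 3] a assms(2) by simp
    finally show "2/3 * rr (?a w) (b w) (c w) * (b w * c w) - ?K \<le> 0"
      by (simp add: a_def u_def mult_ac)
  qed (use assms in auto)
  then show ?thesis unfolding right_diff_distrib by linarith
qed

text \<open>Linear growth bounds \<open>b c\<close> on a bounded time interval, and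
  \<open>b <= b c\<close> once \<open>c >= 1\<close>, so \<open>b\<close> could not diverge. This
  removes the second alternative of \<open>D_infty\<close>.\<close>

lemma no_finite_time_escape:
  assumes P: "P_solution D b0 c0 {0..<T} b c" and "D > 0" "T > 0"
    and lim: "filterlim b at_top (at_left T)" "filterlim c at_top (at_left T)"
  shows False
proof -
  let ?m = "max 1 D"
  let ?K = "2/3 * (2*D^2 + 8*D)"
  have "eventually (\<lambda>t. b t \<ge> ?m \<and> c t \<ge> ?m) (at_left T)"
    using lim unfolding filterlim_at_top by (intro eventually_conj) blast+
  then obtain s0 where s0: "s0 < T" "\<And>t. s0 < t \<Longrightarrow> t < T \<Longrightarrow> b t \<ge> ?m \<and> c t \<ge> ?m"
    unfolding eventually_at_left_field by blast
  define s where "s = (max s0 0 + T) / 2"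
  have s: "s0 < s" "0 < s" "s < T" using s0(1) assms(3) by (auto simp: s_def)
  define B where "B = b s * c s + ?K * (T - s)"
  have bound: "b t * c t \<le> B" if "s \<le> t" "t < T" for t
  proof -
    have "b t * c t \<le> b s * c s + ?K * (t - s)"
      by (rule product_linear_growth[OF P_solution_subset[OF P]])
         (use that s s0 assms in auto)
    also have "\<dots> \<le> B" unfolding B_def using that assms(2) by (intro add_left_mono mult_left_mono) auto
    finally show ?thesis .
  qed
  have "eventually (\<lambda>t. b t \<ge> max 1 (B + 1) \<and> c t \<ge> 1) (at_left T)"
    using lim unfolding filterlim_at_top by (intro eventually_conj) blast+
  moreover have "eventually (\<lambda>t. t > s \<and> t < T) (at_left T)"
    using s(3) unfolding eventually_at_left_field by blast
  ultimately have "eventually (\<lambda>t. False) (at_left T)"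
  proof eventually_elim
    case (elim t)
    have "b t * 1 \<le> b t * c t" using elim by (intro mult_left_mono) auto
    then show False using bound[of t] elim by auto
  qed
  then show False by (simp add: trivial_limit_at_left_real)
qed

section \<open>Asymptotics of escaping trajectories\<close>

text \<open>The threshold 12 gives \<open>b + c <= b c / 6\<close>, hence
  \<open>3 a^3 (b + c) <= a D / 2\<close>: half of the main term \<open>a^2 b c = a D\<close>
  survives in \<open>q\<close>, and more than half in \<open>p\<close>. The three bounds serve, in
  order, the decay of \<open>k\<close>, of \<open>a / k\<close> and of
  \<open>(c - b) / k\<close>.\<close>

lemma asymptotic_bounds:
  fixes a b c D :: real
  assumes "0 < a" "a \<le> 1" "12 \<le> b" "b \<le> c" "a * (b * c) = D"
  shows "pp a b c \<ge> a * D / 2"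
    and "- qq a b c \<le> 4/3 * (c - b)^2 * gap_rate a b c - a * D / 2"
    and "pp a b c / 3 - 2/3 * gap_rate a b c \<le> - 1"
proof -
  have c: "c \<ge> 12" using assms by linarith
  define N where "N = b^2 + b*c + c^2"
  have bc: "b * c \<le> c * c" "b * b \<le> b * c" "12 * b \<le> b * b" "12 * c \<le> b * c"
    using assms c by (auto intro: mult_right_mono mult_left_mono)
  have N: "N \<le> 3 * c^2" "N \<ge> 0"
    using bc assms c unfolding N_def power2_eq_square by linarith+
  have s: "a * (b + c) \<le> N"
  proof -
    have "a * (b + c) \<le> 1 * (b + c)" using assms c by (intro mult_right_mono) auto
    moreover have "b + c \<le> N"
      using bc assms c unfolding N_def power2_eq_square by linarith
    ultimately show ?thesis by simp
  qed
  have D: "D > 0" using assms c by auto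
  have a2: "a^2 * (b * c) = a * D" using assms(5) by (simp add: power2_eq_square)
  have "a^2 * (b + c) \<le> D / 6"
  proof -
    have "b + c \<le> b * c / 6" using bc assms by linarith
    then have "a^2 * (b + c) \<le> a^2 * (b * c / 6)" by (intro mult_left_mono) auto
    also have "\<dots> = a * D / 6" using a2 by simp
    also have "\<dots> \<le> D / 6" using assms D by simp
    finally show ?thesis .
  qed
  then have "a * (a^2 * (b + c)) \<le> a * (D / 6)" using assms by (intro mult_left_mono) auto
  then have a3: "a^3 * (b + c) \<le> a * D / 6" by (simp add: power2_eq_square power3_eq_cube mult.assoc)
  have a3': "a^3 * (b + c) \<ge> 0" and a4: "a^4 \<ge> 0" using assms c by auto
  have a4': "a^4 \<le> 1" "a^2 \<le> 1" using assms by (auto intro: power_le_one)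
  have x0: "(c - b)^2 * (a * (b + c)) \<ge> 0" using assms c by auto
  have xs: "(c - b)^2 * (a * (b + c)) \<le> (c - b)^2 * N" using s by (intro mult_left_mono) auto
  have pp: "pp a b c = (c - b)^2 * N - (c - b)^2 * (a * (b + c)) + a * D - a^3 * (b + c) + a^4"
    unfolding pp_eq_diff N_def a2[symmetric] by algebra
  have qq: "qq a b c = 5*a^4 - 3 * (a^3 * (b + c)) + a * D + (c - b)^2 * (a * (b + c)) - 3 * ((c - b)^2 * N)"
    unfolding qq_eq_diff N_def a2[symmetric] by algebra
  have aD: "a * D \<ge> 0" using assms D by simp
  show "pp a b c \<ge> a * D / 2" unfolding pp using xs a3 a4 aD by linarith
  \<comment> \<open>The term \<open>8 c^4\<close> is kept whole. The others pay for the negative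
    ones: \<open>c^3 b\<close> for \<open>a\<close> times the cubic \<open>S\<close> (using
    \<open>b >= 12\<close> again), \<open>c^2 b^2\<close> for \<open>a^2 b c\<close>, and
    \<open>b^4\<close> for \<open>4 a^4\<close>.\<close>
  have W: "gap_rate a b c \<ge> 8 * c^4"
  proof -
    have b0: "b \<ge> 0" "c \<ge> 0" using assms c by auto
    define S where "S = 5*c^3 + 7*b*c^2 + 7*b^2*c + 5*b^3"
    have "S \<le> 24 * c^3"
    proof -
      have "b * c^2 \<le> c * c^2" "b^2 * c \<le> c^2 * c" "b^3 \<le> c^3"
        using assms(4) b0 by (auto intro!: mult_right_mono power_mono)
      then show ?thesis by (simp add: S_def power2_eq_square power3_eq_cube algebra_simps)
    qed
    moreover have "S \<ge> 0" using b0 by (simp add: S_def)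
    ultimately have "a * S \<le> 1 * (24 * c^3)"
      using assms b0 by (intro mult_mono) auto
    then have "a * S \<le> 24 * c^3" by simp
    moreover have "24 * c^3 \<le> 2 * (c^3 * b)"
      using mult_left_mono[OF assms(3), of "c^3"] b0 by (simp add: mult.commute)
    moreover have "a^2 * b * c \<le> c^2 * b^2"
    proof -
      have "a^2 * (b * c) \<le> 1 * (b * c)" using a4' b0 by (intro mult_right_mono) auto
      also have "\<dots> \<le> (b * c) * (b * c)"
        using mult_mono[of 1 b 1 c] assms c by (intro mult_right_mono) auto
      finally show ?thesis by (simp add: power2_eq_square mult_ac)
    qed
    moreover have "a^4 \<le> b^4" using assms by (intro power_mono) auto
    moreover have "a^3 * (b + c) \<ge> 0" "c^3 * b \<ge> 0" "c^2 * b^2 \<ge> 0" "c * b^3 \<ge> 0" "b^4 \<ge> 0"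
      using assms b0 by auto
    moreover have "gap_rate a b c = 8*c^4 + 7*(c^3*b) + 6*(c^2*b^2) + 7*(c*b^3) + 8*b^4
        - a*S - a^2*b*c + a^3*(b+c) - 4*a^4"
      by (simp add: gap_rate_def S_def mult.assoc)
    ultimately show ?thesis by linarith
  qed
  have c42: "c^2 * 144 \<le> c^4"
  proof -
    have "c^2 * 12^2 \<le> c^2 * c^2" using c by (intro mult_left_mono power_mono) auto
    then show ?thesis by (simp flip: power_add)
  qed
  have c2: "c^2 \<ge> 144" using power_mono[OF c, of 2] by simp
  \<comment> \<open>\<open>N\<close> is quadratic in \<open>c\<close> while the gap rate is quartic,
    so the decay of the squared gap dominates the gap term of \<open>-q\<close>.\<close>
  have "3 * N \<le> 4/3 * gap_rate a b c" using N W c42 c2 by linarith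
  then have "(c - b)^2 * (3 * N) \<le> (c - b)^2 * (4/3 * gap_rate a b c)" by (intro mult_left_mono) auto
  then have "3 * ((c - b)^2 * N) \<le> 4/3 * (c - b)^2 * gap_rate a b c" by (simp add: mult_ac)
  then show "- qq a b c \<le> 4/3 * (c - b)^2 * gap_rate a b c - a * D / 2"
    unfolding qq using a3 a4 x0 by linarith
  have "(c - b)^2 \<le> c^2" using assms c by (intro power_mono) auto
  then have "(c - b)^2 * N \<le> c^2 * (3 * c^2)" using N by (intro mult_mono) auto
  then have xN: "(c - b)^2 * N \<le> 3 * c^4" by (simp flip: power_add add: mult_ac)
  have "a * D \<le> c^2"
  proof -
    have "a^2 * (b * c) \<le> 1 * (c * c)" using a4' bc assms c by (intro mult_mono) auto
    then show ?thesis unfolding a2 by (simp add: power2_eq_square)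
  qed
  then have "pp a b c \<le> 3 * c^4 + c^2 + 1" unfolding pp using xN x0 a3' a4' by linarith
  then show "pp a b c / 3 - 2/3 * gap_rate a b c \<le> - 1" using W c42 c2 by linarith
qed

lemma ln_rate_tendsto:
  fixes \<kappa> :: real
  assumes "\<kappa> > 0" shows "filterlim (\<lambda>s. C + \<kappa> * ln (1 + s)) at_top at_top"
proof -
  have "filterlim (\<lambda>s::real. ln (1 + s)) at_top at_top"
    by (rule filterlim_compose[OF ln_at_top filterlim_tendsto_add_at_top[OF tendsto_const filterlim_ident]])
  then show ?thesis
    by (intro filterlim_tendsto_add_at_top[OF tendsto_const]
        filterlim_tendsto_pos_mult_at_top[OF tendsto_const assms])
qed

section \<open>Limits along one escaping trajectory\<close>

locale escaping_trajectory =
  fixes h0 h1 h2 h3 D :: real and b c :: "real \<Rightarrow> real"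
  assumes h_pos: "h0 > 0" "h1 > 0" "h2 > 0" "h3 > 0" and h23: "h2 \<le> h3"
    and D_eq: "D = h0 * h1 * h2 * h3"
    and P: "P_solution D (root 3 h0 * h2) (root 3 h0 * h3) {0..} b c"
    and b_lim: "filterlim b at_top at_top" and c_lim: "filterlim c at_top at_top"
begin

definition a where "a s = D / (b s * c s)"

lemma D_pos: "D > 0" using h_pos by (simp add: D_eq)

lemma bc_pos: assumes "s \<ge> 0" shows "b s > 0" "c s > 0"
  using P_solution_pos[OF P_solution_subset[OF P], of s] assms h_pos D_pos by auto

lemma a_pos: "s \<ge> 0 \<Longrightarrow> a s > 0" using bc_pos D_pos by (simp add: a_def)

lemma abc: "s \<ge> 0 \<Longrightarrow> a s * (b s * c s) = D" using bc_pos[of s] by (simp add: a_def)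

lemma deriv_b: "s \<ge> 0 \<Longrightarrow>
    (b has_real_derivative (- (2/3) * rr (b s) (a s) (c s) * b s)) (at s within {0..})"
  and deriv_c: "s \<ge> 0 \<Longrightarrow>
    (c has_real_derivative (- (2/3) * rr (c s) (a s) (b s) * c s)) (at s within {0..})"
  using P by (auto simp: P_solution_def a_def)

lemma deriv_a:
  assumes "s \<ge> 0"
  shows "(a has_real_derivative (- (2/3) * rr (a s) (b s) (c s) * a s)) (at s within {0..})"
proof -
  let ?u = "\<lambda>s. b s * c s"
  have u: "(?u has_real_derivative 2/3 * rr (a s) (b s) (c s) * ?u s) (at s within {0..})"
    using P_solution_product[OF P, of s] assms by (simp add: a_def)
  have nz: "?u s \<noteq> 0" using bc_pos[OF assms] by simp
  have "((\<lambda>s. D / ?u s) has_real_derivative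
      (0 * ?u s - D * (2/3 * rr (a s) (b s) (c s) * ?u s)) / (?u s * ?u s)) (at s within {0..})"
    by (rule DERIV_divide[OF DERIV_const u nz])
  moreover have "(0 * ?u s - D * (2/3 * rr (a s) (b s) (c s) * ?u s)) / (?u s * ?u s)
      = - (2/3) * rr (a s) (b s) (c s) * a s"
    unfolding a_def using bc_pos[OF assms] by (simp add: field_simps)
  moreover have "a = (\<lambda>s. D / ?u s)" by (auto simp: a_def)
  ultimately show ?thesis by simp
qed

lemma deriv_gap:
  assumes "s \<ge> 0"
  shows "((\<lambda>s. c s - b s) has_real_derivative
     (c s - b s) * (- (2/3) * gap_rate (a s) (b s) (c s))) (at s within {0..})"
proof -
  have "- (2/3) * rr (c s) (a s) (b s) * c s - - (2/3) * rr (b s) (a s) (c s) * b s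
      = - (2/3) * (rr (c s) (a s) (b s) * c s - rr (b s) (a s) (c s) * b s)"
    by (simp add: algebra_simps)
  also have "\<dots> = (c s - b s) * (- (2/3) * gap_rate (a s) (b s) (c s))"
    by (simp add: gap_rate_eq)
  finally show ?thesis using DERIV_diff[OF deriv_c deriv_b, of s] assms by simp
qed

lemma continuous_abc: "continuous_on {0..} a" "continuous_on {0..} b" "continuous_on {0..} c"
  using deriv_a deriv_b deriv_c by (auto intro!: DERIV_continuous_on)

text \<open>The diagonal \<open>b = c\<close> cannot be crossed: the gap solves a scalar linear
  equation whose coefficient is continuous along the trajectory.\<close>

lemma b_le_c:
  assumes "s \<ge> 0" shows "b s \<le> c s"
proof -
  have "c s - b s \<ge> 0"
  proof (rule linear_ode_nonneg[where f="\<lambda>s. c s - b s"])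
    show "continuous_on {0..} (\<lambda>s. - (2/3) * gap_rate (a s) (b s) (c s))"
      unfolding gap_rate_def by (intro continuous_intros continuous_abc)
    show "0 \<le> c 0 - b 0"
      using P h_pos h23 by (simp add: P_solution_def)
  qed (use deriv_gap assms in auto)
  then show ?thesis by simp
qed

text \<open>The 12 is the threshold of \<open>asymptotic_bounds\<close>; the \<open>D\<close> forces
  \<open>b c >= D\<close>, that is, \<open>a <= 1\<close>.\<close>

definition tail_start :: real where
  "tail_start = (SOME s. s \<ge> 0 \<and> (\<forall>t\<ge>s. b t \<ge> max 12 D \<and> c t \<ge> max 12 D))"

lemma tail_start: "tail_start \<ge> 0" "s \<ge> tail_start \<Longrightarrow> b s \<ge> max 12 D \<and> c s \<ge> max 12 D"
proof -
  have "eventually (\<lambda>t. b t \<ge> max 12 D \<and> c t \<ge> max 12 D) at_top"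
    using b_lim c_lim unfolding filterlim_at_top by (intro eventually_conj) blast+
  then obtain r where "\<forall>t\<ge>r. b t \<ge> max 12 D \<and> c t \<ge> max 12 D"
    unfolding eventually_at_top_linorder by blast
  then have "\<exists>s\<ge>0. \<forall>t\<ge>s. b t \<ge> max 12 D \<and> c t \<ge> max 12 D"
    by (intro exI[of _ "max r 0"]) auto
  then have "tail_start \<ge> 0 \<and> (\<forall>t\<ge>tail_start. b t \<ge> max 12 D \<and> c t \<ge> max 12 D)"
    unfolding tail_start_def by (rule someI_ex)
  then show "tail_start \<ge> 0" "s \<ge> tail_start \<Longrightarrow> b s \<ge> max 12 D \<and> c s \<ge> max 12 D" by auto
qed

lemma a_le_1: assumes "s \<ge> tail_start" shows "a s \<le> 1"
proof -
  have "1 * D \<le> b s * c s" using tail_start(2)[OF assms] D_pos by (intro mult_mono) auto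
  then show ?thesis using D_pos by (simp add: a_def)
qed

lemma tail_bounds:
  assumes "s \<ge> tail_start"
  shows "pp (a s) (b s) (c s) \<ge> a s * D / 2"
    and "- qq (a s) (b s) (c s) \<le> 4/3 * (c s - b s)^2 * gap_rate (a s) (b s) (c s) - a s * D / 2"
    and "pp (a s) (b s) (c s) / 3 - 2/3 * gap_rate (a s) (b s) (c s) \<le> - 1"
proof -
  have s: "s \<ge> 0" using assms tail_start(1) by linarith
  show "pp (a s) (b s) (c s) \<ge> a s * D / 2"
    and "- qq (a s) (b s) (c s) \<le> 4/3 * (c s - b s)^2 * gap_rate (a s) (b s) (c s) - a s * D / 2"
    and "pp (a s) (b s) (c s) / 3 - 2/3 * gap_rate (a s) (b s) (c s) \<le> - 1"
    using asymptotic_bounds[OF a_pos[OF s] a_le_1[OF assms] _ b_le_c[OF s] abc[OF s]]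
      tail_start(2)[OF assms] by auto
qed

lemma a_lower_bound: "\<exists>\<kappa>>0. \<forall>s\<ge>tail_start. a s * D / 2 \<ge> \<kappa> / (1 + s)"
proof -
  let ?K = "2/3 * (2*D^2 + 8*D)" and ?t = tail_start
  \<comment> \<open>One constant above both the initial value and the slope turns the linear bound
    into \<open>b c <= C (1 + s)\<close>. As \<open>a D / 2 = D^2 / (2 b c)\<close>, this gives
    \<open>D^2 / (2 C)\<close> for the witness.\<close>
  define C where "C = max (b ?t * c ?t) ?K"
  have C: "C > 0" using D_pos by (simp add: C_def less_max_iff_disj add_pos_pos)
  have "D^2 / (2 * C) / (1 + s) \<le> a s * D / 2" if s: "s \<ge> ?t" for s
  proof -
    have s0: "s \<ge> 0" using s tail_start(1) by linarith
    have "b s * c s \<le> b ?t * c ?t + ?K * (s - ?t)"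
      using tail_start(1) s D_pos tail_start(2)
      by (intro product_linear_growth[OF P_solution_subset[OF P]]) (auto, (smt (verit))+)
    also have "\<dots> \<le> C + C * s"
    proof (intro add_mono)
      have "?K * (s - ?t) \<le> ?K * s" using tail_start(1) D_pos by (intro mult_left_mono) auto
      also have "\<dots> \<le> C * s" using s0 unfolding C_def by (intro mult_right_mono) auto
      finally show "?K * (s - ?t) \<le> C * s" .
    qed (simp add: C_def)
    finally have "b s * c s \<le> C * (1 + s)" by (simp add: algebra_simps)
    then have "D^2 / (2 * (C * (1 + s))) \<le> D^2 / (2 * (b s * c s))"
      using bc_pos[OF s0] C s0 by (intro divide_left_mono) auto
    then show ?thesis by (simp add: a_def power2_eq_square mult_ac)
  qed
  then show ?thesis using C D_pos by (intro exI[of _ "D^2 / (2 * C)"]) auto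
qed

definition E where
  "E = (SOME F. F 0 = 0 \<and> (\<forall>t\<ge>0. (F has_real_derivative pp (a t) (b t) (c t)) (at t within {0..})))"

lemma E: "E 0 = 0"
    "s \<ge> 0 \<Longrightarrow> (E has_real_derivative pp (a s) (b s) (c s)) (at s within {0..})"
proof -
  have "continuous_on {0..} (\<lambda>s. pp (a s) (b s) (c s))"
    unfolding pp_def by (intro continuous_intros continuous_abc)
  then have "E 0 = 0 \<and> (\<forall>t\<ge>0. (E has_real_derivative pp (a t) (b t) (c t)) (at t within {0..}))"
    unfolding E_def by (rule someI_ex[OF antiderivative_atLeast])
  then show "E 0 = 0"
    "s \<ge> 0 \<Longrightarrow> (E has_real_derivative pp (a s) (b s) (c s)) (at s within {0..})" by auto
qed

text \<open>\<open>E\<close> is chosen so that \<open>k\<close> is the value of $g_{00}^{1/3}$ along the reparametrized flow.\<close>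

definition k where "k s = root 3 h0 * exp (- E s / 3)"

lemma k_pos: "k s > 0" using h_pos by (simp add: k_def)

lemma deriv_k:
  assumes "s \<ge> 0"
  shows "(k has_real_derivative (- (pp (a s) (b s) (c s) / 3) * k s)) (at s within {0..})"
  unfolding k_def[abs_def]
  by (rule derivative_eq_intros E(2) assms | simp)+

lemma E_lim: "filterlim E at_top at_top"
proof -
  let ?t = tail_start
  obtain \<kappa> where \<kappa>: "\<kappa> > 0" "\<And>s. s \<ge> ?t \<Longrightarrow> a s * D / 2 \<ge> \<kappa> / (1 + s)"
    using a_lower_bound by blast
  have *: "(E ?t - \<kappa> * ln (1 + ?t)) + \<kappa> * ln (1 + s) \<le> E s" if "s \<ge> ?t" for s
  proof -
    have "\<kappa> * ln (1 + s) - E s \<le> \<kappa> * ln (1 + ?t) - E ?t"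
    proof (rule nonincreasing_within[where S="{0..}" and f="\<lambda>s. \<kappa> * ln (1 + s) - E s"])
      fix w assume "w \<in> {?t..s}"
      then have w: "w \<ge> ?t" "w \<ge> 0" using tail_start(1) by auto
      show "((\<lambda>s. \<kappa> * ln (1 + s) - E s) has_real_derivative
          \<kappa> / (1 + w) - pp (a w) (b w) (c w)) (at w within {0..})"
        by (rule derivative_eq_intros E(2) w | use w in simp)+
      show "\<kappa> / (1 + w) - pp (a w) (b w) (c w) \<le> 0"
        using \<kappa>(2)[OF w(1)] tail_bounds(1)[OF w(1)] by linarith
    qed (use that tail_start(1) in auto)
    then show ?thesis by linarith
  qed
  show ?thesis
    by (rule filterlim_at_top_mono[OF ln_rate_tendsto[OF \<kappa>(1)]])
       (use * in \<open>auto simp: eventually_at_top_linorder\<close>)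
qed

lemma k_lim: "(k \<longlongrightarrow> 0) at_top"
proof -
  have "filterlim (\<lambda>s. - E s / 3) at_bot at_top"
    using filterlim_tendsto_pos_mult_at_top[OF tendsto_const[of "1/3"] _ E_lim]
    by (simp add: filterlim_uminus_at_top)
  then have "((\<lambda>s. exp (- E s / 3)) \<longlongrightarrow> 0) at_top"
    by (rule filterlim_compose[OF exp_at_bot])
  then show ?thesis unfolding k_def[abs_def] by (rule tendsto_mult_right_zero)
qed

text \<open>The logarithmic derivative of \<open>a / k\<close> is \<open>-q\<close>, which has no
  definite sign by itself: it contains three times \<open>(c-b)^2 (b^2 + b c + c^2)\<close> with a
  plus sign. Adding \<open>(c-b)^2\<close> to the logarithm repairs this, since its derivative is
  \<open>-4/3 (c-b)^2 W\<close> and outweighs that term.\<close>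

lemma a_div_k_lim: "((\<lambda>s. a s / k s) \<longlongrightarrow> 0) at_top"
proof -
  let ?t = tail_start
  let ?v = "\<lambda>s. ln (a s) - ln (k s) + (c s - b s)^2"
  obtain \<kappa> where \<kappa>: "\<kappa> > 0" "\<And>s. s \<ge> ?t \<Longrightarrow> a s * D / 2 \<ge> \<kappa> / (1 + s)"
    using a_lower_bound by blast
  have *: "(- ?v ?t - \<kappa> * ln (1 + ?t)) + \<kappa> * ln (1 + s) \<le> - ln (a s / k s)" if "s \<ge> ?t" for s
  proof -
    have "\<kappa> * ln (1 + s) + ?v s \<le> \<kappa> * ln (1 + ?t) + ?v ?t"
    proof (rule nonincreasing_within[where S="{0..}" and f="\<lambda>s. \<kappa> * ln (1 + s) + ?v s"])
      fix w assume "w \<in> {?t..s}"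
      then have w: "w \<ge> ?t" "w \<ge> 0" using tail_start(1) by auto
      let ?p = "pp (a w) (b w) (c w)" and ?q = "qq (a w) (b w) (c w)"
        and ?W = "gap_rate (a w) (b w) (c w)"
      have "((\<lambda>s. ln (a s)) has_real_derivative - (2/3) * rr (a w) (b w) (c w)) (at w within {0..})"
        using a_pos[OF w(2)] DERIV_chain2[OF DERIV_ln_divide deriv_a, of w] w by simp
      moreover have "((\<lambda>s. ln (k s)) has_real_derivative - (?p / 3)) (at w within {0..})"
        using k_pos[of w] DERIV_chain2[OF DERIV_ln_divide deriv_k, of w] w by simp
      moreover have "((\<lambda>s. (c s - b s)^2) has_real_derivative
          - (4/3 * (c w - b w)^2 * ?W)) (at w within {0..})"
        by (rule DERIV_cong[OF DERIV_power[OF deriv_gap[OF w(2)], of 2]])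
           (simp add: power2_eq_square field_simps)
      ultimately have "(?v has_real_derivative
          - (2/3) * rr (a w) (b w) (c w) - - (?p / 3) + - (4/3 * (c w - b w)^2 * ?W)) (at w within {0..})"
        by (intro DERIV_add DERIV_diff)
      also have "- (2/3) * rr (a w) (b w) (c w) - - (?p / 3) = - ?q"
        by (simp add: rr_def field_simps)
      finally have v: "(?v has_real_derivative - ?q + - (4/3 * (c w - b w)^2 * ?W)) (at w within {0..})" .
      show "((\<lambda>s. \<kappa> * ln (1 + s) + ?v s) has_real_derivative
          \<kappa> / (1 + w) + (- ?q + - (4/3 * (c w - b w)^2 * ?W))) (at w within {0..})"
        by (rule DERIV_add[OF _ v]) (rule derivative_eq_intros | use w in simp)+
      show "\<kappa> / (1 + w) + (- ?q + - (4/3 * (c w - b w)^2 * ?W)) \<le> 0"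
        using \<kappa>(2)[OF w(1)] tail_bounds(2)[OF w(1)] by linarith
    qed (use that tail_start(1) in auto)
    moreover have "ln (a s / k s) = ln (a s) - ln (k s)"
      using a_pos[of s] k_pos[of s] that tail_start(1) by (simp add: ln_div)
    \<comment> \<open>The correction is nonnegative, so an upper bound for \<open>?v\<close> is also
      one for the logarithm alone.\<close>
    moreover have "(c s - b s)^2 \<ge> 0" by simp
    ultimately show ?thesis by linarith
  qed
  have "filterlim (\<lambda>s. - ln (a s / k s)) at_top at_top"
    by (rule filterlim_at_top_mono[OF ln_rate_tendsto[OF \<kappa>(1)]])
       (use * in \<open>auto simp: eventually_at_top_linorder\<close>)
  then have "((\<lambda>s. exp (ln (a s / k s))) \<longlongrightarrow> 0) at_top"
    by (intro filterlim_compose[OF exp_at_bot]) (simp add: filterlim_uminus_at_top)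
  moreover have "eventually (\<lambda>s. exp (ln (a s / k s)) = a s / k s) at_top"
    using eventually_ge_at_top[of 0] by eventually_elim (use a_pos k_pos in simp)
  ultimately show ?thesis by (rule Lim_transform_eventually)
qed

text \<open>Division by \<open>k\<close> adds \<open>p/3\<close> to the rate \<open>-2/3 W\<close>
  of the gap. Here \<open>p\<close> is at most \<open>3 c^4\<close> plus lower order, against
  \<open>W >= 8 c^4\<close>, so the contraction wins; rate 1 is more than enough.\<close>

lemma gap_div_k_lim: "((\<lambda>s. (c s - b s) / k s) \<longlongrightarrow> 0) at_top"
proof -
  let ?t = tail_start
  let ?y = "\<lambda>s. (c s - b s) / k s"
  have y0: "?y s \<ge> 0" if "s \<ge> 0" for s using b_le_c[OF that] k_pos[of s] by simp
  have *: "?y s \<le> ?y ?t * exp ?t * exp (- s)" if "s \<ge> ?t" for s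
  proof -
    have "?y s * exp s \<le> ?y ?t * exp ?t"
    proof (rule nonincreasing_within[where S="{0..}" and f="\<lambda>s. ?y s * exp s"])
      fix w assume "w \<in> {?t..s}"
      then have w: "w \<ge> ?t" "w \<ge> 0" using tail_start(1) by auto
      let ?p = "pp (a w) (b w) (c w)" and ?W = "gap_rate (a w) (b w) (c w)"
      have k: "k w \<noteq> 0" using k_pos[of w] by simp
      have y: "(?y has_real_derivative ?y w * (?p / 3 - 2/3 * ?W)) (at w within {0..})"
        by (rule DERIV_cong[OF DERIV_divide[OF deriv_gap[OF w(2)] deriv_k[OF w(2)] k]])
           (use k in \<open>simp add: field_simps\<close>)
      show "((\<lambda>s. ?y s * exp s) has_real_derivative
          (?y w * (?p / 3 - 2/3 * ?W + 1)) * exp w) (at w within {0..})"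
        by (rule DERIV_cong[OF DERIV_mult[OF y DERIV_subset[OF DERIV_exp]]])
           (simp_all add: algebra_simps)
      have "?y w * (?p / 3 - 2/3 * ?W + 1) \<le> 0"
        using y0[OF w(2)] tail_bounds(3)[OF w(1)] by (intro mult_nonneg_nonpos) auto
      then show "(?y w * (?p / 3 - 2/3 * ?W + 1)) * exp w \<le> 0"
        by (rule mult_nonpos_nonneg) simp
    qed (use that tail_start(1) in auto)
    then have "?y s * exp s * exp (- s) \<le> ?y ?t * exp ?t * exp (- s)"
      by (intro mult_right_mono) auto
    then show ?thesis by (simp add: mult.assoc flip: exp_add)
  qed
  have lim: "((\<lambda>s. ?y ?t * exp ?t * exp (- s)) \<longlongrightarrow> 0) at_top"
    by (intro tendsto_mult_right_zero filterlim_compose[OF exp_at_bot]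
        filterlim_uminus_at_bot_at_top)
  show ?thesis
    by (rule tendsto_sandwich[OF _ _ tendsto_const lim])
       (use y0 * in \<open>auto intro: eventually_at_top_linorderI[of 0] eventually_at_top_linorderI[of ?t]\<close>)
qed

lemma b_div_k_lim: "filterlim (\<lambda>s. b s / k s) at_top at_top"
proof (rule filterlim_at_top_mono[OF b_lim])
  have "eventually (\<lambda>s. k s < 1) at_top"
    using order_tendstoD(2)[OF k_lim, of 1] by simp
  then show "eventually (\<lambda>s. b s \<le> b s / k s) at_top"
    using eventually_ge_at_top[of 0]
  proof eventually_elim
    case (elim s)
    then show ?case
      using bc_pos(1)[of s] k_pos[of s] by (simp add: field_simps)
  qed
qed

end

section \<open>From the planar system to (S3)\<close>

text \<open>Here \<open>\<phi>\<close> is the speed \<open>dt/ds\<close> of the new clock. Its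
  positive lower bound makes \<open>t\<close> run to infinity with \<open>s\<close>, so the inverse
  \<open>\<sigma>\<close> is defined for all \<open>t >= 0\<close>.\<close>

lemma inverse_time_change:
  fixes \<phi> :: "real \<Rightarrow> real"
  assumes "continuous_on {0..} \<phi>" "\<kappa> > 0" "\<And>s. s \<ge> 0 \<Longrightarrow> \<phi> s \<ge> \<kappa>"
  shows "\<exists>\<sigma>. \<sigma> 0 = 0 \<and> (\<forall>t\<ge>0. \<sigma> t \<ge> 0 \<and>
            (\<sigma> has_real_derivative 1 / \<phi> (\<sigma> t)) (at t within {0..})) \<and>
          filterlim \<sigma> at_top at_top"
proof -
  \<comment> \<open>Extending the speed by its value at 0 makes the clock a bijection of the whole
    line, so the two-sided inverse function rule also applies at time 0.\<close>
  define \<psi> where "\<psi> s = \<phi> (max 0 s)" for s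
  have \<psi>: "\<psi> s \<ge> \<kappa>" for s using assms(3) by (simp add: \<psi>_def)
  have "continuous_on UNIV \<psi>" unfolding \<psi>_def
    by (rule continuous_on_compose2[OF assms(1)]) (auto intro!: continuous_intros)
  then have "isCont \<psi> s" for s by (simp add: continuous_on_eq_continuous_at)
  then have "\<exists>F. \<forall>s. - \<infinity> < ereal s \<longrightarrow> ereal s < \<infinity> \<longrightarrow> (F has_vector_derivative \<psi> s) (at s)"
    by (intro einterval_antiderivative) auto
  then obtain F where F: "\<And>s. (F has_real_derivative \<psi> s) (at s)"
    by (auto simp: has_real_derivative_iff_has_vector_derivative)
  define G where "G s = F s - F 0" for s
  have G: "(G has_real_derivative \<psi> s) (at s)" for s
    unfolding G_def[abs_def] by (rule derivative_eq_intros F | simp)+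
  have G0: "G 0 = 0" by (simp add: G_def)
  \<comment> \<open>Expansion by at least \<open>\<kappa>\<close> yields injectivity, the bracket
    \<open>\<bar>t\<bar> / \<kappa>\<close> for surjectivity, and the Lipschitz bound that makes the
    inverse continuous.\<close>
  have expand: "\<kappa> * (y - x) \<le> G y - G x" if "x \<le> y" for x y
  proof -
    have "G x - \<kappa> * x \<le> G y - \<kappa> * y"
    proof (rule DERIV_nonneg_imp_nondecreasing[OF that])
      fix s
      have "((\<lambda>s. G s - \<kappa> * s) has_real_derivative \<psi> s - \<kappa>) (at s)"
        by (rule DERIV_diff[OF G DERIV_cmult_Id])
      then show "\<exists>y. ((\<lambda>s. G s - \<kappa> * s) has_real_derivative y) (at s) \<and> 0 \<le> y"
        using \<psi>[of s] by auto
    qed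
    then show ?thesis by (simp add: algebra_simps)
  qed
  have mono: "G x < G y" if "x < y" for x y
    using expand[of x y] that assms(2) by (smt (verit) mult_pos_pos)
  have surj: "\<exists>s. G s = t" for t
  proof -
    have "\<exists>s\<ge>- (\<bar>t\<bar> / \<kappa>). s \<le> \<bar>t\<bar> / \<kappa> \<and> G s = t"
    proof (rule IVT')
      show "G (- (\<bar>t\<bar> / \<kappa>)) \<le> t" using expand[of "- (\<bar>t\<bar> / \<kappa>)" 0] assms(2) G0 by simp
      show "t \<le> G (\<bar>t\<bar> / \<kappa>)" using expand[of 0 "\<bar>t\<bar> / \<kappa>"] assms(2) G0 by simp
      show "- (\<bar>t\<bar> / \<kappa>) \<le> \<bar>t\<bar> / \<kappa>" using assms(2) by simp
      show "continuous_on {- (\<bar>t\<bar> / \<kappa>)..\<bar>t\<bar> / \<kappa>} G"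
        using G by (meson DERIV_isCont continuous_at_imp_continuous_on)
    qed
    then show ?thesis by blast
  qed
  define \<sigma> where "\<sigma> t = (SOME s. G s = t)" for t
  have G\<sigma>: "G (\<sigma> t) = t" for t unfolding \<sigma>_def by (rule someI_ex[OF surj])
  have le_\<sigma>: "s \<le> \<sigma> t" if "G s \<le> t" for s t
    using mono[of "\<sigma> t" s] G\<sigma>[of t] that by linarith
  have \<sigma>0: "\<sigma> 0 = 0" using G\<sigma>[of 0] G0 mono by (metis linorder_neqE_linordered_idom less_irrefl)
  have lip: "\<bar>\<sigma> y - \<sigma> x\<bar> \<le> \<bar>y - x\<bar> / \<kappa>" for x y
    using expand[of "\<sigma> x" "\<sigma> y"] expand[of "\<sigma> y" "\<sigma> x"] assms(2) G\<sigma>[of x] G\<sigma>[of y]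
    by (cases "\<sigma> x \<le> \<sigma> y") (auto simp: field_simps)
  have cont: "isCont \<sigma> t" for t
  proof -
    have "((\<lambda>y. \<bar>y - t\<bar> / \<kappa>) \<longlongrightarrow> \<bar>t - t\<bar> / \<kappa>) (at t)"
      using assms(2) by (intro tendsto_intros) auto
    then have lim: "((\<lambda>y. \<bar>y - t\<bar> / \<kappa>) \<longlongrightarrow> 0) (at t)" by simp
    have "((\<lambda>y. \<sigma> y - \<sigma> t) \<longlongrightarrow> 0) (at t)"
      by (rule Lim_null_comparison[OF always_eventually lim])
         (simp only: real_norm_def lip simp_thms)
    then show ?thesis by (simp add: isCont_def LIM_zero_iff)
  qed
  have deriv: "(\<sigma> has_real_derivative inverse (\<psi> (\<sigma> t))) (at t)" for t
    by (rule DERIV_inverse_function[where f=G and a="t - 1" and b="t + 1"])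
       (use G G\<sigma> cont \<psi>[of "\<sigma> t"] assms(2) in auto)
  have nonneg: "\<sigma> t \<ge> 0" if "t \<ge> 0" for t using le_\<sigma>[of 0 t] G0 that by simp
  have "filterlim \<sigma> at_top at_top"
    unfolding filterlim_at_top eventually_at_top_linorder using le_\<sigma> by blast
  moreover have "(\<sigma> has_real_derivative 1 / \<phi> (\<sigma> t)) (at t within {0..})" if "t \<ge> 0" for t
    using DERIV_subset[OF deriv[of t], of "{0..}"] nonneg[OF that]
    by (simp add: \<psi>_def inverse_eq_divide max_def)
  ultimately show ?thesis using \<sigma>0 nonneg by blast
qed

text \<open>Pairs of bounded functions whose difference is $O(d)$ on $S$ are closed under ring operations,
  which yields the Lipschitz estimate for a polynomial vector field along two solutions.\<close>

definition lipschitz_pair ::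
  "real set \<Rightarrow> (real \<Rightarrow> real) \<Rightarrow> (real \<Rightarrow> real) \<Rightarrow> (real \<Rightarrow> real) \<Rightarrow> bool" where
  "lipschitz_pair S d u v \<longleftrightarrow>
     (\<exists>M. \<forall>t\<in>S. \<bar>u t\<bar> \<le> M \<and> \<bar>v t\<bar> \<le> M) \<and> (\<exists>K. \<forall>t\<in>S. \<bar>u t - v t\<bar> \<le> K * d t)"

lemma lipschitz_pair_const: "lipschitz_pair S d (\<lambda>_. x) (\<lambda>_. x)"
  unfolding lipschitz_pair_def by (intro conjI exI[of _ "\<bar>x\<bar>"] exI[of _ 0]) auto

lemma lipschitz_pair_add:
  assumes "lipschitz_pair S d u v" "lipschitz_pair S d u' v'"
  shows "lipschitz_pair S d (\<lambda>t. u t + u' t) (\<lambda>t. v t + v' t)"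
proof -
  obtain M K M' K' where
    *: "\<And>t. t \<in> S \<Longrightarrow> \<bar>u t\<bar> \<le> M \<and> \<bar>v t\<bar> \<le> M \<and> \<bar>u t - v t\<bar> \<le> K * d t"
       "\<And>t. t \<in> S \<Longrightarrow> \<bar>u' t\<bar> \<le> M' \<and> \<bar>v' t\<bar> \<le> M' \<and> \<bar>u' t - v' t\<bar> \<le> K' * d t"
    using assms unfolding lipschitz_pair_def by metis
  have "\<bar>u t + u' t\<bar> \<le> M + M' \<and> \<bar>v t + v' t\<bar> \<le> M + M'" if "t \<in> S" for t
    using *[OF that] by linarith
  moreover have "\<bar>(u t + u' t) - (v t + v' t)\<bar> \<le> (K + K') * d t" if "t \<in> S" for t
    using *[OF that] unfolding distrib_right by linarith
  ultimately show ?thesis unfolding lipschitz_pair_def by blast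
qed

lemma lipschitz_pair_mult:
  assumes "lipschitz_pair S d u v" "lipschitz_pair S d u' v'"
  shows "lipschitz_pair S d (\<lambda>t. u t * u' t) (\<lambda>t. v t * v' t)"
proof -
  obtain M K M' K' where
    *: "\<And>t. t \<in> S \<Longrightarrow> \<bar>u t\<bar> \<le> M \<and> \<bar>v t\<bar> \<le> M \<and> \<bar>u t - v t\<bar> \<le> K * d t"
       "\<And>t. t \<in> S \<Longrightarrow> \<bar>u' t\<bar> \<le> M' \<and> \<bar>v' t\<bar> \<le> M' \<and> \<bar>u' t - v' t\<bar> \<le> K' * d t"
    using assms unfolding lipschitz_pair_def by metis
  have "\<bar>u t * u' t\<bar> \<le> M * M' \<and> \<bar>v t * v' t\<bar> \<le> M * M'" if "t \<in> S" for t
    using *[OF that] by (auto simp: abs_mult intro!: mult_mono)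
  moreover have "\<bar>u t * u' t - v t * v' t\<bar> \<le> (M * K' + M' * K) * d t" if "t \<in> S" for t
  proof -
    have "u t * u' t - v t * v' t = u t * (u' t - v' t) + v' t * (u t - v t)" by algebra
    then have "\<bar>u t * u' t - v t * v' t\<bar> \<le> \<bar>u t\<bar> * \<bar>u' t - v' t\<bar> + \<bar>v' t\<bar> * \<bar>u t - v t\<bar>"
      by (metis abs_mult abs_triangle_ineq)
    also have "\<dots> \<le> M * (K' * d t) + M' * (K * d t)"
      using *[OF that] by (intro add_mono mult_mono) auto
    finally show ?thesis by (simp add: algebra_simps)
  qed
  ultimately show ?thesis unfolding lipschitz_pair_def by blast
qed

lemma lipschitz_pair_minus:
  assumes "lipschitz_pair S d u v" shows "lipschitz_pair S d (\<lambda>t. - u t) (\<lambda>t. - v t)"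
  using lipschitz_pair_mult[OF lipschitz_pair_const[of S d "-1"] assms] by simp

lemma lipschitz_pair_diff:
  assumes "lipschitz_pair S d u v" "lipschitz_pair S d u' v'"
  shows "lipschitz_pair S d (\<lambda>t. u t - u' t) (\<lambda>t. v t - v' t)"
  using lipschitz_pair_add[OF assms(1) lipschitz_pair_minus[OF assms(2)]] by simp

lemma lipschitz_pair_power:
  assumes "lipschitz_pair S d u v" shows "lipschitz_pair S d (\<lambda>t. u t ^ n) (\<lambda>t. v t ^ n)"
  by (induction n) (auto intro: lipschitz_pair_const lipschitz_pair_mult assms)

lemmas lipschitz_pair_intros = lipschitz_pair_const lipschitz_pair_add lipschitz_pair_diff
  lipschitz_pair_minus lipschitz_pair_mult lipschitz_pair_power

lemma lipschitz_pair_bound: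
  assumes "lipschitz_pair S d u v" "\<And>t. t \<in> S \<Longrightarrow> d t \<ge> 0"
  shows "\<exists>K\<ge>0. \<forall>t\<in>S. \<bar>u t - v t\<bar> \<le> K * d t"
proof -
  obtain K where "\<forall>t\<in>S. \<bar>u t - v t\<bar> \<le> K * d t"
    using assms(1) unfolding lipschitz_pair_def by blast
  then have "\<forall>t\<in>S. \<bar>u t - v t\<bar> \<le> max K 0 * d t"
    using assms(2) by (meson max.cobounded1 mult_right_mono order_trans)
  then show ?thesis by (intro exI[of _ "max K 0"]) auto
qed

text \<open>A Gronwall argument, which transfers the limits of one explicit solution to every
  solution. The Lipschitz estimate is natural in the sum of absolute differences \<open>d\<close>,
  but the sum of squares \<open>Q\<close> is differentiable.\<close>

lemma S3_solution_unique:
  assumes g: "S3_solution h0 h1 h2 h3 {0..} g0 g1 g2 g3"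
    and g': "S3_solution h0 h1 h2 h3 {0..} g0' g1' g2' g3'" and "t \<ge> 0"
  shows "g0 t = g0' t \<and> g1 t = g1' t \<and> g2 t = g2' t \<and> g3 t = g3' t"
proof -
  define \<beta> where "\<beta> = bach_beta (h0 * h1 * h2 * h3)"
  let ?S = "{0..t}"
  define e0 e1 e2 e3 where "e0 s = g0 s - g0' s" and "e1 s = g1 s - g1' s"
    and "e2 s = g2 s - g2' s" and "e3 s = g3 s - g3' s" for s
  define d where "d s = \<bar>e0 s\<bar> + \<bar>e1 s\<bar> + \<bar>e2 s\<bar> + \<bar>e3 s\<bar>" for s
  have d0: "d s \<ge> 0" for s by (simp add: d_def)
  define f0 f1 f2 f3 where
    "f0 x0 x1 x2 x3 = - \<beta> * pp x1 x2 x3 * x0^3" and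
    "f1 x0 x1 x2 x3 = - \<beta> * qq x1 x2 x3 * x0^2 * x1" and
    "f2 x0 x1 x2 x3 = - \<beta> * qq x2 x3 x1 * x0^2 * x2" and
    "f3 x0 x1 x2 x3 = - \<beta> * qq x3 x1 x2 * x0^2 * x3" for x0 x1 x2 x3
  note f_defs = f0_def f1_def f2_def f3_def
  have D: "(g0 has_real_derivative f0 (g0 s) (g1 s) (g2 s) (g3 s)) (at s within {0..})"
      "(g1 has_real_derivative f1 (g0 s) (g1 s) (g2 s) (g3 s)) (at s within {0..})"
      "(g2 has_real_derivative f2 (g0 s) (g1 s) (g2 s) (g3 s)) (at s within {0..})"
      "(g3 has_real_derivative f3 (g0 s) (g1 s) (g2 s) (g3 s)) (at s within {0..})"
    if "s \<ge> 0" for s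
    using g that unfolding S3_solution_def Let_def f_defs \<beta>_def by auto
  have D': "(g0' has_real_derivative f0 (g0' s) (g1' s) (g2' s) (g3' s)) (at s within {0..})"
      "(g1' has_real_derivative f1 (g0' s) (g1' s) (g2' s) (g3' s)) (at s within {0..})"
      "(g2' has_real_derivative f2 (g0' s) (g1' s) (g2' s) (g3' s)) (at s within {0..})"
      "(g3' has_real_derivative f3 (g0' s) (g1' s) (g2' s) (g3' s)) (at s within {0..})"
    if "s \<ge> 0" for s
    using g' that unfolding S3_solution_def Let_def f_defs \<beta>_def by auto
  have pair: "lipschitz_pair ?S d u v"
    if "\<And>s. s \<ge> 0 \<Longrightarrow> (u has_real_derivative u' s) (at s within {0..})"
      "\<And>s. s \<ge> 0 \<Longrightarrow> (v has_real_derivative v' s) (at s within {0..})"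
      "\<And>s. \<bar>u s - v s\<bar> \<le> d s" for u v u' v'
  proof -
    have "continuous_on {0..} u" "continuous_on {0..} v"
      using that by (auto intro!: DERIV_continuous_on)
    then have "continuous_on ?S u" "continuous_on ?S v"
      by (auto intro: continuous_on_subset)
    then obtain M M' where "\<forall>s\<in>?S. \<bar>u s\<bar> \<le> M" "\<forall>s\<in>?S. \<bar>v s\<bar> \<le> M'"
      using continuous_on_interval_bounded by metis
    then have "\<forall>s\<in>?S. \<bar>u s\<bar> \<le> max M M' \<and> \<bar>v s\<bar> \<le> max M M'" by (auto simp: le_max_iff_disj)
    then show ?thesis
      unfolding lipschitz_pair_def using that(3) by (metis mult_1)
  qed
  note pairs = pair[OF D(1) D'(1)] pair[OF D(2) D'(2)] pair[OF D(3) D'(3)] pair[OF D(4) D'(4)]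
  have p: "lipschitz_pair ?S d g0 g0'" "lipschitz_pair ?S d g1 g1'"
    "lipschitz_pair ?S d g2 g2'" "lipschitz_pair ?S d g3 g3'"
    by (rule pairs; simp add: d_def e0_def e1_def e2_def e3_def)+
  define F0 F1 F2 F3 where
    "F0 s = f0 (g0 s) (g1 s) (g2 s) (g3 s) - f0 (g0' s) (g1' s) (g2' s) (g3' s)" and
    "F1 s = f1 (g0 s) (g1 s) (g2 s) (g3 s) - f1 (g0' s) (g1' s) (g2' s) (g3' s)" and
    "F2 s = f2 (g0 s) (g1 s) (g2 s) (g3 s) - f2 (g0' s) (g1' s) (g2' s) (g3' s)" and
    "F3 s = f3 (g0 s) (g1 s) (g2 s) (g3 s) - f3 (g0' s) (g1' s) (g2' s) (g3' s)" for s
  have "lipschitz_pair ?S d (\<lambda>s. f0 (g0 s) (g1 s) (g2 s) (g3 s)) (\<lambda>s. f0 (g0' s) (g1' s) (g2' s) (g3' s))"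
    "lipschitz_pair ?S d (\<lambda>s. f1 (g0 s) (g1 s) (g2 s) (g3 s)) (\<lambda>s. f1 (g0' s) (g1' s) (g2' s) (g3' s))"
    "lipschitz_pair ?S d (\<lambda>s. f2 (g0 s) (g1 s) (g2 s) (g3 s)) (\<lambda>s. f2 (g0' s) (g1' s) (g2' s) (g3' s))"
    "lipschitz_pair ?S d (\<lambda>s. f3 (g0 s) (g1 s) (g2 s) (g3 s)) (\<lambda>s. f3 (g0' s) (g1' s) (g2' s) (g3' s))"
    unfolding f_defs pp_def qq_def by (intro lipschitz_pair_intros p)+
  note F = this[THEN lipschitz_pair_bound, OF d0, folded F0_def F1_def F2_def F3_def]
  obtain K0 K1 K2 K3 where K: "K0 \<ge> 0" "K1 \<ge> 0" "K2 \<ge> 0" "K3 \<ge> 0"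
    and FK: "\<And>s. s \<in> ?S \<Longrightarrow> \<bar>F0 s\<bar> \<le> K0 * d s" "\<And>s. s \<in> ?S \<Longrightarrow> \<bar>F1 s\<bar> \<le> K1 * d s"
    "\<And>s. s \<in> ?S \<Longrightarrow> \<bar>F2 s\<bar> \<le> K2 * d s" "\<And>s. s \<in> ?S \<Longrightarrow> \<bar>F3 s\<bar> \<le> K3 * d s"
    using F by metis
  define K where "K = K0 + K1 + K2 + K3"
  have K_ge: "K \<ge> 0" "K0 \<le> K" "K1 \<le> K" "K2 \<le> K" "K3 \<le> K" using K by (auto simp: K_def)
  define Q where "Q s = e0 s^2 + e1 s^2 + e2 s^2 + e3 s^2" for s
  have prod: "e * f \<le> \<bar>e\<bar> * (K * d s)" if "\<bar>f\<bar> \<le> K' * d s" "K' \<le> K" for e f K' s :: real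
  proof -
    have "\<bar>f\<bar> \<le> K * d s" using that mult_right_mono[OF that(2) d0[of s]] by linarith
    then have "\<bar>e\<bar> * \<bar>f\<bar> \<le> \<bar>e\<bar> * (K * d s)" by (intro mult_left_mono) auto
    then show ?thesis using abs_ge_self[of "e * f"] by (simp add: abs_mult)
  qed
  \<comment> \<open>Cauchy-Schwarz for four terms. With \<open>Q' <= 2 K d^2\<close> it gives the
    exponent \<open>8 K\<close> used below.\<close>
  have d_sq: "d s * d s \<le> 4 * Q s" for s
  proof -
    have "4 * (w^2 + x^2 + y^2 + z^2) - (w + x + y + z) * (w + x + y + z) =
        (w - x)^2 + (w - y)^2 + (w - z)^2 + (x - y)^2 + (x - z)^2 + (y - z)^2" for w x y z :: real
      by algebra
    then have "4 * (w^2 + x^2 + y^2 + z^2) - (w + x + y + z) * (w + x + y + z) \<ge> 0" for w x y z :: real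
      by simp
    from this[of "\<bar>e0 s\<bar>" "\<bar>e1 s\<bar>" "\<bar>e2 s\<bar>" "\<bar>e3 s\<bar>"] show ?thesis
      by (simp add: d_def Q_def)
  qed
  have "Q t * exp (- (8 * K) * t) \<le> Q 0 * exp (- (8 * K) * 0)"
  proof (rule nonincreasing_within[where S="{0..}" and f="\<lambda>s. Q s * exp (- (8 * K) * s)"])
    fix s assume s: "s \<in> {0..t}"
    then have s0: "s \<ge> 0" by simp
    have e: "(e0 has_real_derivative F0 s) (at s within {0..})"
      "(e1 has_real_derivative F1 s) (at s within {0..})"
      "(e2 has_real_derivative F2 s) (at s within {0..})"
      "(e3 has_real_derivative F3 s) (at s within {0..})"
      unfolding e0_def[abs_def] e1_def[abs_def] e2_def[abs_def] e3_def[abs_def]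
        F0_def F1_def F2_def F3_def
      by (intro DERIV_diff D D' s0)+
    let ?Q' = "2 * (e0 s * F0 s + e1 s * F1 s + e2 s * F2 s + e3 s * F3 s)"
    have Q: "(Q has_real_derivative ?Q') (at s within {0..})"
      unfolding Q_def[abs_def] by (rule derivative_eq_intros e | simp)+
    show "((\<lambda>s. Q s * exp (- (8 * K) * s)) has_real_derivative
        (?Q' - 8 * K * Q s) * exp (- (8 * K) * s)) (at s within {0..})"
      by (rule derivative_eq_intros Q | simp add: algebra_simps)+
    have "e0 s * F0 s + e1 s * F1 s + e2 s * F2 s + e3 s * F3 s \<le>
        \<bar>e0 s\<bar> * (K * d s) + \<bar>e1 s\<bar> * (K * d s) + \<bar>e2 s\<bar> * (K * d s) + \<bar>e3 s\<bar> * (K * d s)"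
      by (intro add_mono prod[OF FK(1)] prod[OF FK(2)] prod[OF FK(3)] prod[OF FK(4)] s K_ge)
    also have "\<dots> = K * (d s * d s)" unfolding d_def by algebra
    also have "\<dots> \<le> K * (4 * Q s)" using d_sq K_ge(1) by (intro mult_left_mono)
    finally have "?Q' - 8 * K * Q s \<le> 0" by simp
    then show "(?Q' - 8 * K * Q s) * exp (- (8 * K) * s) \<le> 0"
      by (rule mult_nonpos_nonneg) simp
  qed (use assms(3) in auto)
  moreover have "Q 0 = 0"
    using g g' by (simp add: Q_def e0_def e1_def e2_def e3_def S3_solution_def Let_def)
  ultimately have "Q t \<le> 0" by (simp add: mult_le_0_iff)
  then have "e0 t = 0 \<and> e1 t = 0 \<and> e2 t = 0 \<and> e3 t = 0"
    unfolding Q_def by (smt (verit) zero_le_power2 power2_eq_iff_nonneg zero_eq_power2)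
  then show ?thesis by (simp add: e0_def e1_def e2_def e3_def)
qed

context escaping_trajectory
begin

text \<open>Generic in \<open>f\<close> to serve \<open>a\<close>, \<open>b\<close> and
  \<open>c\<close> alike: \<open>p\<close> is symmetric, so all three share the same
  \<open>k\<close>, and \<open>2/3 r - p/3 = q\<close> for each order of the arguments.\<close>

lemma deriv_div_k:
  assumes "s \<ge> 0" "(f has_real_derivative (- (2/3) * rr x y z * f s)) (at s within {0..})"
    and "pp x y z = pp (a s) (b s) (c s)"
  shows "((\<lambda>s. f s / k s) has_real_derivative - qq x y z * (f s / k s)) (at s within {0..})"
proof -
  have k: "k s \<noteq> 0" using k_pos[of s] by simp
  show ?thesis
    by (rule DERIV_cong[OF DERIV_divide[OF assms(2) deriv_k[OF assms(1)] k]])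
       (use k in \<open>simp add: assms(3)[symmetric] rr_def field_simps\<close>)
qed

text \<open>The arguments on the right are in the cyclic order of (S3), those on the left in the
  order of (P); the symmetry of \<open>qq\<close> in its last two arguments reconciles them.\<close>

lemma scale_k:
  "pp (a s) (b s) (c s) = k s^4 * pp (a s / k s) (b s / k s) (c s / k s)"
  "qq (a s) (b s) (c s) = k s^4 * qq (a s / k s) (b s / k s) (c s / k s)"
  "qq (b s) (a s) (c s) = k s^4 * qq (b s / k s) (c s / k s) (a s / k s)"
  "qq (c s) (a s) (b s) = k s^4 * qq (c s / k s) (a s / k s) (b s / k s)"
  using k_pos[of s] by (simp_all add: qq_commute[of "b s" "a s"] flip: pp_scale qq_scale)

text \<open>An upper bound on \<open>k\<close> is a positive lower bound on
  \<open>dt/ds = 1 / (\<beta> k^2)\<close>, as the time change requires.\<close>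

lemma k_bounded: "\<exists>B. \<forall>s\<ge>0. k s \<le> B"
proof -
  have "eventually (\<lambda>s. k s < 1) at_top"
    using order_tendstoD(2)[OF k_lim, of 1] by simp
  then obtain N where N: "\<And>s. s \<ge> N \<Longrightarrow> k s < 1"
    unfolding eventually_at_top_linorder by blast
  have "continuous_on {0..} k" using deriv_k by (auto intro!: DERIV_continuous_on)
  then have "continuous_on {0..N} k" by (rule continuous_on_subset) auto
  then obtain M where "\<forall>s\<in>{0..N}. \<bar>k s\<bar> \<le> M" using continuous_on_interval_bounded by blast
  then have "k s \<le> max 1 M" if "s \<ge> 0" for s
    using N[of s] that by (cases "s \<le> N") (force simp: le_max_iff_disj)+
  then show ?thesis by blast
qed

lemma S3_solution_reparametrized:
  "\<exists>\<sigma>. filterlim \<sigma> at_top at_top \<and>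
     S3_solution h0 h1 h2 h3 {0..} (\<lambda>t. k (\<sigma> t)^3) (\<lambda>t. a (\<sigma> t) / k (\<sigma> t))
       (\<lambda>t. b (\<sigma> t) / k (\<sigma> t)) (\<lambda>t. c (\<sigma> t) / k (\<sigma> t))"
proof -
  define \<beta> where "\<beta> = bach_beta (h0 * h1 * h2 * h3)"
  have \<beta>: "\<beta> > 0" using h_pos by (simp add: \<beta>_def bach_beta_def)
  obtain B where B: "\<And>s. s \<ge> 0 \<Longrightarrow> k s \<le> B" using k_bounded by blast
  have B0: "B > 0" using B[of 0] k_pos[of 0] by simp
  have k0: "k s \<noteq> 0" for s using k_pos[of s] by simp
  have "continuous_on {0..} k" using deriv_k by (auto intro!: DERIV_continuous_on)
  then have "continuous_on {0..} (\<lambda>s. 1 / (\<beta> * k s^2))"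
    using \<beta> k0 by (intro continuous_intros) auto
  moreover have "1 / (\<beta> * B^2) > 0" using \<beta> B0 by simp
  moreover have "1 / (\<beta> * B^2) \<le> 1 / (\<beta> * k s^2)" if "s \<ge> 0" for s
    using \<beta> k_pos[of s] B[OF that] B0 by (intro divide_left_mono mult_left_mono power_mono) auto
  ultimately have "\<exists>\<sigma>. \<sigma> 0 = 0 \<and> (\<forall>t\<ge>0. \<sigma> t \<ge> 0 \<and>
        (\<sigma> has_real_derivative 1 / (1 / (\<beta> * k (\<sigma> t)^2))) (at t within {0..})) \<and>
      filterlim \<sigma> at_top at_top"
    by (rule inverse_time_change)
  then obtain \<sigma> where \<sigma>: "\<sigma> 0 = 0" "\<And>t. t \<ge> 0 \<Longrightarrow> \<sigma> t \<ge> 0"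
      "\<And>t. t \<ge> 0 \<Longrightarrow> (\<sigma> has_real_derivative 1 / (1 / (\<beta> * k (\<sigma> t)^2))) (at t within {0..})"
      "filterlim \<sigma> at_top at_top"
    by blast
  have chain: "((\<lambda>t. f (\<sigma> t)) has_real_derivative f' * (\<beta> * k (\<sigma> t)^2)) (at t within {0..})"
    if "t \<ge> 0" "(f has_real_derivative f') (at (\<sigma> t) within {0..})" for f f' t
  proof -
    have "(f has_real_derivative f') (at (\<sigma> t) within \<sigma> ` {0..})"
      using that(2) by (rule DERIV_subset) (use \<sigma>(2) in auto)
    from DERIV_image_chain[OF this \<sigma>(3)[OF that(1)]] show ?thesis by (simp add: o_def)
  qed
  have init: "b 0 = root 3 h0 * h2" "c 0 = root 3 h0 * h3" "k 0 = root 3 h0"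
    using P E(1) by (auto simp: P_solution_def k_def)
  have r3: "root 3 h0 ^ 3 = h0" and r0: "root 3 h0 > 0" using h_pos by auto
  have a0: "a 0 / k 0 = h1"
  proof -
    have "a 0 / k 0 = D / (root 3 h0 ^ 3 * h2 * h3)"
      by (simp add: a_def init power3_eq_cube mult_ac)
    also have "\<dots> = h0 * h1 * h2 * h3 / (root 3 h0 ^ 3 * h2 * h3)" by (subst D_eq) simp
    finally show ?thesis using h_pos by (simp add: r3)
  qed
  have "S3_solution h0 h1 h2 h3 {0..} (\<lambda>t. k (\<sigma> t)^3) (\<lambda>t. a (\<sigma> t) / k (\<sigma> t))
       (\<lambda>t. b (\<sigma> t) / k (\<sigma> t)) (\<lambda>t. c (\<sigma> t) / k (\<sigma> t))"
    unfolding S3_solution_def Let_def \<beta>_def[symmetric]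
  proof (intro conjI ballI)
    fix t :: real assume "t \<in> {0..}"
    then have t: "t \<ge> 0" by simp
    let ?s = "\<sigma> t"
    note s = \<sigma>(2)[OF t]
    have k3: "((\<lambda>s. k s^3) has_real_derivative - pp (a ?s) (b ?s) (c ?s) * k ?s^3) (at ?s within {0..})"
      by (rule DERIV_cong[OF DERIV_power[OF deriv_k[OF s], of 3]])
         (simp add: power2_eq_square power3_eq_cube)
    show "((\<lambda>t. k (\<sigma> t)^3) has_real_derivative
        - \<beta> * pp (a ?s / k ?s) (b ?s / k ?s) (c ?s / k ?s) * (k ?s^3)^3) (at t within {0..})"
      by (rule DERIV_cong[OF chain[OF t k3]]) (simp only: scale_k, algebra)
    show "((\<lambda>t. a (\<sigma> t) / k (\<sigma> t)) has_real_derivative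
        - \<beta> * qq (a ?s / k ?s) (b ?s / k ?s) (c ?s / k ?s) * (k ?s^3)^2 * (a ?s / k ?s)) (at t within {0..})"
      by (rule DERIV_cong[OF chain[OF t deriv_div_k[OF s deriv_a[OF s]]]])
         (simp, simp only: scale_k, algebra)
    show "((\<lambda>t. b (\<sigma> t) / k (\<sigma> t)) has_real_derivative
        - \<beta> * qq (b ?s / k ?s) (c ?s / k ?s) (a ?s / k ?s) * (k ?s^3)^2 * (b ?s / k ?s)) (at t within {0..})"
      by (rule DERIV_cong[OF chain[OF t deriv_div_k[OF s deriv_b[OF s]]]])
         (rule pp_commute, simp only: scale_k, algebra)
    show "((\<lambda>t. c (\<sigma> t) / k (\<sigma> t)) has_real_derivative
        - \<beta> * qq (c ?s / k ?s) (a ?s / k ?s) (b ?s / k ?s) * (k ?s^3)^2 * (c ?s / k ?s)) (at t within {0..})"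
      by (rule DERIV_cong[OF chain[OF t deriv_div_k[OF s deriv_c[OF s]]]])
         (rule pp_commute, simp only: scale_k, algebra)
  qed (use \<sigma>(1) init a0 r0 r3 in auto)
  then show ?thesis using \<sigma>(4) by blast
qed

end

theorem theorem5p21:
  fixes h0 h1 h2 h3 :: real
  assumes "h0 > 0" "h1 > 0" "h2 > 0" "h3 > 0"
    and "h1 \<le> h2" "h2 \<le> h3"
    and "D_infty h0 h1 h2 h3"
  shows "(\<exists>g0 g1 g2 g3. S3_solution h0 h1 h2 h3 {0..} g0 g1 g2 g3) \<and>
         (\<forall>g0 g1 g2 g3. S3_solution h0 h1 h2 h3 {0..} g0 g1 g2 g3 \<longrightarrow>
            (g0 \<longlongrightarrow> 0) at_top \<and> (g1 \<longlongrightarrow> 0) at_top \<and>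
            filterlim g2 at_top at_top \<and> filterlim g3 at_top at_top \<and>
            ((\<lambda>t. g3 t - g2 t) \<longlongrightarrow> 0) at_top)"
proof -
  let ?D = "h0 * h1 * h2 * h3"
  have "?D > 0" using assms by simp
  then obtain b c where bc: "P_solution ?D (root 3 h0 * h2) (root 3 h0 * h3) {0..} b c"
      "filterlim b at_top at_top" "filterlim c at_top at_top"
    using assms(7) no_finite_time_escape unfolding D_infty_def Let_def by blast
  interpret escaping_trajectory h0 h1 h2 h3 ?D b c
    using assms bc by unfold_locales auto
  obtain \<sigma> where \<sigma>: "filterlim \<sigma> at_top at_top"
    and sol: "S3_solution h0 h1 h2 h3 {0..} (\<lambda>t. k (\<sigma> t)^3) (\<lambda>t. a (\<sigma> t) / k (\<sigma> t))
       (\<lambda>t. b (\<sigma> t) / k (\<sigma> t)) (\<lambda>t. c (\<sigma> t) / k (\<sigma> t))"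
    using S3_solution_reparametrized by blast
  have "(g0 \<longlongrightarrow> 0) at_top \<and> (g1 \<longlongrightarrow> 0) at_top \<and>
        filterlim g2 at_top at_top \<and> filterlim g3 at_top at_top \<and>
        ((\<lambda>t. g3 t - g2 t) \<longlongrightarrow> 0) at_top"
    if g: "S3_solution h0 h1 h2 h3 {0..} g0 g1 g2 g3" for g0 g1 g2 g3
  proof -
    note eq = S3_solution_unique[OF sol g]
    have ev: "eventually (\<lambda>t. u t = v t) at_top" if "\<And>t. t \<ge> 0 \<Longrightarrow> u t = v t"
      for u v :: "real \<Rightarrow> real"
      using that by (auto simp: eventually_at_top_linorder)
    have "((\<lambda>t. k (\<sigma> t)^3) \<longlongrightarrow> 0) at_top"
      using tendsto_power[OF filterlim_compose[OF k_lim \<sigma>], of 3] by simp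
    then have 0: "(g0 \<longlongrightarrow> 0) at_top"
      by (rule Lim_transform_eventually) (use eq in \<open>intro ev, auto\<close>)
    have 1: "(g1 \<longlongrightarrow> 0) at_top"
      by (rule Lim_transform_eventually[OF filterlim_compose[OF a_div_k_lim \<sigma>]])
         (use eq in \<open>intro ev, auto\<close>)
    have 2: "filterlim g2 at_top at_top"
      by (rule filterlim_at_top_mono[OF filterlim_compose[OF b_div_k_lim \<sigma>]])
         (use eq in \<open>auto intro!: eventually_at_top_linorderI[of 0]\<close>)
    have 4: "((\<lambda>t. g3 t - g2 t) \<longlongrightarrow> 0) at_top"
      by (rule Lim_transform_eventually[OF filterlim_compose[OF gap_div_k_lim \<sigma>]])
         (use eq in \<open>intro ev, auto simp: diff_divide_distrib\<close>)
    \<comment> \<open>\<open>g3\<close> inherits divergence from \<open>g2\<close>, since their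
      difference converges.\<close>
    have "filterlim (\<lambda>t. (g3 t - g2 t) + g2 t) at_top at_top"
      by (rule filterlim_tendsto_add_at_top[OF 4 2])
    then have "filterlim g3 at_top at_top" by simp
    with 0 1 2 4 show ?thesis by blast
  qed
  then show ?thesis using sol by blast
qed

end
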